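(* If $\kappa$ is a cardinal number with $\kappa\ge\mathfrak c$, then there exists a nontrivial twisted sum of $c_0$ and $C(2^\kappa)$, where $2^\kappa=\{0,1\}^\kappa$ carries the product topology.
   Context: For a compact Hausdorff space $K$, $C(K)$ is the Banach space of continuous real-valued functions on $K$ with the supremum norm; $c_0$ is the Banach space of real sequences converging to zero. For Banach spaces $Y,X$, a twisted sum of $Y$ and $X$ is a short exact sequence $0\to Y\to Z\to X\to 0$ with $Z$ a Banach space and bounded linear maps; it is trivial if the image of $Y\to Z$ is complemented in $Z$. $\mathfrak c$ is the cardinality of the continuum. *)

theory Defs
  imports "HOL-Analysis.Analysis" "HOL-Library.Function_Algebras"
begin

instantiation "fun" :: (type, real_vector) real_vector
begin
definition scaleR_fun :: "real \<Rightarrow> ('a \<Rightarrow> 'b) \<Rightarrow> 'a \<Rightarrow> 'b"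
  where "scaleR_fun c f = (\<lambda>x. c *\<^sub>R f x)"
instance
  by standard (auto simp: scaleR_fun_def fun_eq_iff scaleR_add_right scaleR_add_left)
end

definition banach_on :: "'v::real_vector set \<Rightarrow> ('v \<Rightarrow> real) \<Rightarrow> bool" where
  "banach_on V n \<longleftrightarrow>
     subspace V \<and>
     (\<forall>x\<in>V. 0 \<le> n x \<and> (n x = 0 \<longleftrightarrow> x = 0)) \<and>
     (\<forall>x\<in>V. \<forall>c. n (c *\<^sub>R x) = \<bar>c\<bar> * n x) \<and>
     (\<forall>x\<in>V. \<forall>y\<in>V. n (x + y) \<le> n x + n y) \<and>
     (\<forall>s. (\<forall>k. s k \<in> V) \<and> (\<forall>e>0. \<exists>N. \<forall>j\<ge>N. \<forall>k\<ge>N. n (s j - s k) < e)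
          \<longrightarrow> (\<exists>l\<in>V. (\<lambda>k. n (s k - l)) \<longlonglongrightarrow> 0))"

definition bounded_linear_on ::
  "'v::real_vector set \<Rightarrow> ('v \<Rightarrow> real) \<Rightarrow> 'w::real_vector set \<Rightarrow> ('w \<Rightarrow> real) \<Rightarrow> ('v \<Rightarrow> 'w) \<Rightarrow> bool" where
  "bounded_linear_on V nV W nW T \<longleftrightarrow>
     (\<forall>x\<in>V. T x \<in> W) \<and>
     (\<forall>x\<in>V. \<forall>y\<in>V. T (x + y) = T x + T y) \<and>
     (\<forall>x\<in>V. \<forall>c. T (c *\<^sub>R x) = c *\<^sub>R T x) \<and>
     (\<exists>C. \<forall>x\<in>V. nW (T x) \<le> C * nV x)"

definition twisted_sum ::
  "'y::real_vector set \<Rightarrow> ('y \<Rightarrow> real) \<Rightarrow> 'z::real_vector set \<Rightarrow> ('z \<Rightarrow> real)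
   \<Rightarrow> 'x::real_vector set \<Rightarrow> ('x \<Rightarrow> real) \<Rightarrow> ('y \<Rightarrow> 'z) \<Rightarrow> ('z \<Rightarrow> 'x) \<Rightarrow> bool" where
  "twisted_sum Y nY Z nZ X nX i q \<longleftrightarrow>
     banach_on Y nY \<and> banach_on Z nZ \<and> banach_on X nX \<and>
     bounded_linear_on Y nY Z nZ i \<and> bounded_linear_on Z nZ X nX q \<and>
     inj_on i Y \<and> q ` Z = X \<and> i ` Y = {z \<in> Z. q z = 0}"

definition closed_in_norm :: "'v::real_vector set \<Rightarrow> ('v \<Rightarrow> real) \<Rightarrow> 'v set \<Rightarrow> bool" where
  "closed_in_norm V n W \<longleftrightarrow>
     (\<forall>s l. (\<forall>k. s k \<in> W) \<and> l \<in> V \<and> (\<lambda>k. n (s k - l)) \<longlonglongrightarrow> 0 \<longrightarrow> l \<in> W)"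

definition complemented :: "'v::real_vector set \<Rightarrow> ('v \<Rightarrow> real) \<Rightarrow> 'v set \<Rightarrow> bool" where
  "complemented V n M \<longleftrightarrow>
     (\<exists>W. subspace W \<and> W \<subseteq> V \<and> closed_in_norm V n W \<and>
          M \<inter> W = {0} \<and> {m + w | m w. m \<in> M \<and> w \<in> W} = V)"

definition trivial_twisted_sum ::
  "'y::real_vector set \<Rightarrow> 'z::real_vector set \<Rightarrow> ('z \<Rightarrow> real) \<Rightarrow> ('y \<Rightarrow> 'z) \<Rightarrow> bool" where
  "trivial_twisted_sum Y Z nZ i \<longleftrightarrow> complemented Z nZ (i ` Y)"

definition c0_set :: "(nat \<Rightarrow> real) set" where
  "c0_set = {s. s \<longlonglongrightarrow> 0}"

definition c0_norm :: "(nat \<Rightarrow> real) \<Rightarrow> real" where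
  "c0_norm s = (SUP k. \<bar>s k\<bar>)"

text \<open>The Cantor cube 2^K = {0,1}^K with the product of discrete topologies;
  points are extensional functions K \<rightarrow> bool.\<close>
definition cantor_cube :: "'k set \<Rightarrow> ('k \<Rightarrow> bool) topology" where
  "cantor_cube K = product_topology (\<lambda>_. discrete_topology (UNIV :: bool set)) K"

text \<open>C(2^K): continuous real functions on the cantor cube, normalised to 0 off the
  topspace so that each element of C(2^K) has a unique representative.\<close>
definition CK_set :: "'k set \<Rightarrow> (('k \<Rightarrow> bool) \<Rightarrow> real) set" where
  "CK_set K = {f. continuous_map (cantor_cube K) euclideanreal f \<and>
                 (\<forall>x. x \<notin> topspace (cantor_cube K) \<longrightarrow> f x = 0)}"

definition CK_norm :: "'k set \<Rightarrow> (('k \<Rightarrow> bool) \<Rightarrow> real) \<Rightarrow> real" where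
  "CK_norm K f = (SUP x\<in>topspace (cantor_cube K). \<bar>f x\<bar>)"

end

theory Submission
  imports Defs
begin

text \<open>
  Let (A l) be an almost disjoint family of sets of integers, indexed by the sets l of integers, and
  let (phi l) be bounded functionals on X = C(2^K) such that (phi l x) is a c_0 family for every x.
  Gluing phi l x along A l defines a bounded operator from X to l_inf / c_0, and its pullback Z is a
  twisted sum of c_0 and X. If Z is trivial, the bounded inverse theorem gives a bounded linear
  S : X -> l_inf lifting the operator.

  Take phi l f = f(p_n + e_l) - f(p_n), where n depends on l, the points p_n lie in disjoint clopen
  sets U_n depending on countably many coordinates only, and e_l flips a coordinate reserved for l.
  Let B_n be the set of k such that the k-th coordinate functional of S exceeds 1/2 somewhere on the
  unit ball of C(U_n). As S is bounded and the U_n are disjoint, each k lies in boundedly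
  many B_n. The sequence (B_n) is coded by a set l of integers, so there are at most continuum many
  of them and each A l can be chosen to defeat the sequence coded by l: shrink a branch of the
  binary tree to its points outside B_n, for some n = n(l) which keeps it infinite. For f the
  indicator of the part of U_n where coordinate l is 1, S f is close to 1 along A l, but less than
  1/2 there since A l misses B_n.
\<close>

section \<open>The bounded inverse theorem\<close>

locale banach_space =
  fixes V :: "'v::real_vector set" and n :: "'v \<Rightarrow> real"
  assumes banach: "banach_on V n"
begin

lemma subspace: "subspace V"
  and nonneg: "x \<in> V \<Longrightarrow> 0 \<le> n x"
  and eq_0_iff: "x \<in> V \<Longrightarrow> n x = 0 \<longleftrightarrow> x = 0"
  and scale: "x \<in> V \<Longrightarrow> n (c *\<^sub>R x) = \<bar>c\<bar> * n x"
  and triangle: "x \<in> V \<Longrightarrow> y \<in> V \<Longrightarrow> n (x + y) \<le> n x + n y"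
  using banach by (auto simp: banach_on_def)

lemma complete:
  assumes "\<And>k. s k \<in> V" and "\<And>e. e > 0 \<Longrightarrow> \<exists>N. \<forall>j\<ge>N. \<forall>k\<ge>N. n (s j - s k) < e"
  obtains l where "l \<in> V" "(\<lambda>k. n (s k - l)) \<longlonglongrightarrow> 0"
proof -
  have "\<exists>l\<in>V. (\<lambda>k. n (s k - l)) \<longlonglongrightarrow> 0"
    using banach assms by (simp add: banach_on_def)
  then show thesis using that by blast
qed

lemmas closed [simp] = subspace_0[OF subspace] subspace_add[OF subspace]
  subspace_diff[OF subspace] subspace_scale[OF subspace]

lemma norm_0 [simp]: "n 0 = 0"
  by (simp add: eq_0_iff)

lemma norm_minus_commute: "x \<in> V \<Longrightarrow> y \<in> V \<Longrightarrow> n (x - y) = n (y - x)"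
  using scale[of "x - y" "-1"] by simp

lemma triangle_diff:
  "x \<in> V \<Longrightarrow> y \<in> V \<Longrightarrow> z \<in> V \<Longrightarrow> n (x - z) \<le> n (x - y) + n (y - z)"
  using triangle[of "x - y" "y - z"] by simp

lemma norm_diff_le: "x \<in> V \<Longrightarrow> y \<in> V \<Longrightarrow> n (x - y) \<le> n x + n y"
  using triangle_diff[of x 0 y] norm_minus_commute[of 0 y] by simp

text \<open>The cut-off outside V makes this symmetric and nonnegative on the whole type, as the locale
  demands.\<close>
definition dst where "dst x y = (if x \<in> V \<and> y \<in> V then n (x - y) else 0)"

sublocale metric_of: Metric_space V dst
proof
  fix x y z
  show "0 \<le> dst x y" by (simp add: dst_def nonneg)
  show "dst x y = dst y x" by (simp add: dst_def norm_minus_commute)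
  show "x \<in> V \<Longrightarrow> y \<in> V \<Longrightarrow> dst x y = 0 \<longleftrightarrow> x = y" by (simp add: dst_def eq_0_iff)
  show "x \<in> V \<Longrightarrow> y \<in> V \<Longrightarrow> z \<in> V \<Longrightarrow> dst x z \<le> dst x y + dst y z"
    by (simp add: dst_def triangle_diff)
qed

lemma metric_of_mcomplete: metric_of.mcomplete
  unfolding metric_of.mcomplete_def
proof (intro allI impI)
  fix s :: "nat \<Rightarrow> _" assume "metric_of.MCauchy s"
  then have sV: "\<And>k. s k \<in> V" and C: "\<And>e. e > 0 \<Longrightarrow> \<exists>N. \<forall>j\<ge>N. \<forall>k\<ge>N. dst (s j) (s k) < e"
    by (auto simp: metric_of.MCauchy_def)
  obtain l where l: "l \<in> V" "(\<lambda>k. n (s k - l)) \<longlonglongrightarrow> 0"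
    by (rule complete[of s]) (use sV C in \<open>auto simp: dst_def\<close>)
  have "limitin metric_of.mtopology s l sequentially"
    unfolding metric_of.limit_metric_sequentially
  proof (intro conjI allI impI)
    fix e :: real assume "e > 0"
    from order_tendstoD(2)[OF l(2) this]
    show "\<exists>N. \<forall>k\<ge>N. s k \<in> V \<and> dst (s k) l < e"
      using sV l by (simp add: eventually_sequentially dst_def)
  qed (use l in auto)
  then show "\<exists>l. limitin metric_of.mtopology s l sequentially" ..
qed

text \<open>Completeness of c_0, of C(2^K), of the twisted sum and of a complement is obtained from
  this, each being closed in a space already known to be complete.\<close>

lemma banach_on_closed_subspace:
  assumes "subspace W" "W \<subseteq> V" "closed_in_norm V n W"
  shows "banach_on W n"
  unfolding banach_on_def
proof (intro conjI allI impI)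
  fix s :: "nat \<Rightarrow> _" assume s: "(\<forall>k. s k \<in> W) \<and> (\<forall>e>0. \<exists>N. \<forall>j\<ge>N. \<forall>k\<ge>N. n (s j - s k) < e)"
  obtain l where l: "l \<in> V" "(\<lambda>k. n (s k - l)) \<longlonglongrightarrow> 0"
    by (rule complete[of s]) (use s assms(2) in auto)
  then show "\<exists>l\<in>W. (\<lambda>k. n (s k - l)) \<longlonglongrightarrow> 0"
    using assms(3) s unfolding closed_in_norm_def by blast
qed (use assms in \<open>auto simp: nonneg eq_0_iff scale triangle subset_iff\<close>)

end

lemma bounded_linear_onD:
  assumes "bounded_linear_on V nV W nW T" "subspace V"
  shows "x \<in> V \<Longrightarrow> T x \<in> W"
    and "x \<in> V \<Longrightarrow> y \<in> V \<Longrightarrow> T (x + y) = T x + T y"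
    and "x \<in> V \<Longrightarrow> T (c *\<^sub>R x) = c *\<^sub>R T x"
    and "T 0 = 0"
    and "x \<in> V \<Longrightarrow> y \<in> V \<Longrightarrow> T (x - y) = T x - T y"
proof -
  show 1: "x \<in> V \<Longrightarrow> T x \<in> W" "x \<in> V \<Longrightarrow> y \<in> V \<Longrightarrow> T (x + y) = T x + T y"
    and 2: "x \<in> V \<Longrightarrow> T (c *\<^sub>R x) = c *\<^sub>R T x" for x y c
    using assms by (auto simp: bounded_linear_on_def)
  show "T 0 = 0" using 2[of 0 0] subspace_0[OF assms(2)] by simp
  show "x \<in> V \<Longrightarrow> y \<in> V \<Longrightarrow> T (x - y) = T x - T y"
    using 1(2)[of x "-1 *\<^sub>R y"] 2[of y "-1"] subspace_neg[OF assms(2), of y] by simp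
qed

text \<open>By Baire, the closure of the image of some ball has an interior point. Translation and
  scaling turn this into approximate preimages with norm control. Correcting the error again and
  again gives a convergent series whose sum is an exact preimage, and injectivity identifies it with
  the given one.\<close>

theorem bounded_inverse:
  fixes q :: "'w::real_vector \<Rightarrow> 'x::real_vector"
  assumes W: "banach_on W nW" and X: "banach_on X nX"
    and q: "bounded_linear_on W nW X nX q" and inj: "inj_on q W" and surj: "q ` W = X"
  obtains C where "C \<ge> 0" "\<And>w. w \<in> W \<Longrightarrow> nW w \<le> C * nX (q w)"
proof -
  interpret W: banach_space W nW by unfold_locales (rule W)
  interpret X: banach_space X nX by unfold_locales (rule X)
  note ql = bounded_linear_onD[OF q W.subspace]
  obtain Q where Q: "\<And>w. w \<in> W \<Longrightarrow> nX (q w) \<le> Q * nW w"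
    using q unfolding bounded_linear_on_def by blast
  define E where "E m = q ` {w \<in> W. nW w \<le> real m}" for m :: nat
  \<comment> \<open>By surjectivity the sets \<open>E m\<close> cover \<open>X\<close>, which is its
    own interior and contains 0. So their closures cannot all have empty interior.\<close>
  have "\<exists>m. X.metric_of.mtopology interior_of (X.metric_of.mtopology closure_of E m) \<noteq> {}"
  proof (rule ccontr)
    assume "\<not> ?thesis"
    then have "X.metric_of.mtopology interior_of (\<Union>(range (\<lambda>m. X.metric_of.mtopology closure_of E m))) = {}"
      by (intro X.metric_of.metric_Baire_category_alt X.metric_of_mcomplete) auto
    moreover have "E m \<subseteq> X.metric_of.mtopology closure_of E m" for m
      using ql(1) by (intro closure_of_subset) (auto simp: E_def)
    then have "X \<subseteq> \<Union>(range (\<lambda>m. X.metric_of.mtopology closure_of E m))"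
      using surj real_arch_simple by (fastforce simp: E_def)
    then have "X.metric_of.mtopology interior_of X
        \<subseteq> X.metric_of.mtopology interior_of (\<Union>(range (\<lambda>m. X.metric_of.mtopology closure_of E m)))"
      by (rule interior_of_mono)
    moreover have "X.metric_of.mtopology interior_of X = X"
      using interior_of_topspace[of X.metric_of.mtopology] by simp
    ultimately show False using X.closed(1) by blast
  qed
  then obtain m x0 r where x0: "x0 \<in> X" "r > 0"
    and sub: "X.metric_of.mball x0 r \<subseteq> X.metric_of.mtopology closure_of E m"
    by (auto simp: X.metric_of.metric_interior_of)
  have near: "\<exists>w\<in>W. nW w \<le> real m \<and> nX (x - q w) < d"
    if "x \<in> X" "nX (x0 - x) < r" "d > 0" for x d
  proof -
    have "x \<in> X.metric_of.mtopology closure_of E m"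
      using that x0 sub by (auto simp: X.metric_of.in_mball X.dst_def)
    then have "\<exists>y\<in>E m. y \<in> X.metric_of.mball x d"
      using that(3) unfolding X.metric_of.metric_closure_of by blast
    then show ?thesis
      using that ql(1) by (auto simp: E_def X.metric_of.in_mball X.dst_def split: if_splits)
  qed
  \<comment> \<open>Subtracting approximate preimages of \<open>x0 + x\<close> and of
    \<open>x0\<close> moves the centre of the ball to 0. This doubles the norm bound and adds up two
    errors, each kept below \<open>d/2\<close>.\<close>
  have small: "\<exists>w\<in>W. nW w \<le> 2 * real m \<and> nX (x - q w) < d"
    if x: "x \<in> X" "nX x < r" "d > 0" for x d
  proof -
    have "nX (x0 - (x0 + x)) = nX x"
      using X.scale[of x "-1"] x by simp
    then obtain w1 where w1: "w1 \<in> W" "nW w1 \<le> m" "nX (x0 + x - q w1) < d/2"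
      using near[of "x0 + x" "d/2"] x x0 by auto
    obtain w2 where w2: "w2 \<in> W" "nW w2 \<le> m" "nX (x0 - q w2) < d/2"
      using near[of x0 "d/2"] x x0 by auto
    have "nW (w1 - w2) \<le> nW w1 + nW w2"
      using w1 w2 by (intro W.norm_diff_le)
    moreover have "nX (x - q (w1 - w2)) \<le> nX (x0 + x - q w1) + nX (x0 - q w2)"
    proof -
      have "x - q (w1 - w2) = (x0 + x - q w1) - (x0 - q w2)"
        using ql(5)[of w1 w2] w1 w2 by simp
      then show ?thesis
        using X.norm_diff_le[of "x0 + x - q w1" "x0 - q w2"] ql(1) w1 w2 x0 x by (metis X.closed(2,3))
    qed
    ultimately show ?thesis
      using w1 w2 by (intro bexI[of _ "w1 - w2"]) auto
  qed
  \<comment> \<open>Rescaling x to norm \<open>r/2\<close> uses the factor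
    \<open>t = r / (2 * nX x)\<close>; dividing the bound \<open>2 * m\<close> by t gives
    \<open>4 * m / r\<close> times the norm of x.\<close>
  define C where "C = 4 * real m / r"
  have "C \<ge> 0" using x0 by (simp add: C_def)
  have "\<exists>w\<in>W. nW w \<le> C * nX x \<and> nX (x - q w) < d" if x: "x \<in> X" "d > 0" for x d
  proof (cases "x = 0")
    case True
    then show ?thesis using x ql(4) by (intro bexI[of _ 0]) auto
  next
    case False
    then have pos: "nX x > 0" using X.nonneg[OF x(1)] X.eq_0_iff[OF x(1)] by linarith
    define t where "t = r / (2 * nX x)"
    have t: "t > 0" using pos x0 by (simp add: t_def)
    have "nX (t *\<^sub>R x) < r"
      using x t pos x0 by (simp add: X.scale t_def)
    then obtain w where w: "w \<in> W" "nW w \<le> 2 * real m" "nX (t *\<^sub>R x - q w) < d * t"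
      using small[of "t *\<^sub>R x" "d * t"] x t by auto
    have "nW ((1/t) *\<^sub>R w) \<le> C * nX x"
      using w t pos x0 by (simp add: W.scale C_def t_def field_simps)
    moreover have "x - q ((1/t) *\<^sub>R w) = (1/t) *\<^sub>R (t *\<^sub>R x - q w)"
      using w t by (simp add: ql(3) scaleR_diff_right)
    moreover have "nX ((1/t) *\<^sub>R (t *\<^sub>R x - q w)) < d"
      using w t x ql(1) by (subst X.scale) (simp_all add: field_simps)
    ultimately show ?thesis using w by (intro bexI[of _ "(1/t) *\<^sub>R w"]) auto
  qed
  then obtain g where g: "\<And>x d. x \<in> X \<Longrightarrow> d > 0 \<Longrightarrow> g x d \<in> W \<and> nW (g x d) \<le> C * nX x \<and> nX (x - q (g x d)) < d"
    by metis
  show thesis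
  proof (rule that)
    show "2 * C \<ge> 0" using \<open>C \<ge> 0\<close> by simp
    fix w assume w: "w \<in> W"
    define x where "x = q w"
    have xX: "x \<in> X" using w ql(1) by (simp add: x_def)
    show "nW w \<le> 2 * C * nX (q w)"
    proof (cases "x = 0")
      case True
      then have "w = 0" using inj_onD[OF inj, of w 0] w ql(4) by (simp add: x_def)
      then show ?thesis using ql(4) by simp
    next
      case False
      define a where "a = nX x"
      have a: "a > 0" using False X.nonneg[OF xX] X.eq_0_iff[OF xX] by (simp add: a_def)
      \<comment> \<open>Successive approximation: each step adds an approximate preimage of the
        remaining error and at least halves the bound on that error. The increments are then
        dominated by a geometric series.\<close>
      define s where "s = rec_nat 0 (\<lambda>j v. v + g (x - q v) (a / 2 ^ Suc j))"
      have s0: "s 0 = 0" and sS: "s (Suc j) = s j + g (x - q (s j)) (a / 2 ^ Suc j)" for j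
        by (simp_all add: s_def)
      have s: "s j \<in> W \<and> nX (x - q (s j)) \<le> a / 2 ^ j" for j
      proof (induction j)
        case 0
        then show ?case using ql(4) by (simp add: s0 a_def)
      next
        case (Suc j)
        have "x - q (s j) \<in> X" using Suc xX ql(1) by simp
        note gg = g[OF this, of "a / 2 ^ Suc j"]
        have eq: "x - q (s (Suc j)) = (x - q (s j)) - q (g (x - q (s j)) (a / 2 ^ Suc j))"
          using gg a Suc by (simp add: sS ql(2))
        have "s (Suc j) \<in> W" using gg a Suc by (simp add: sS)
        moreover have "nX (x - q (s (Suc j))) \<le> a / 2 ^ Suc j" unfolding eq using gg a by simp
        ultimately show ?case ..
      qed
      have step: "nW (s (Suc j) - s j) \<le> C * a / 2 ^ j" for j
      proof -
        have "x - q (s j) \<in> X" using s xX ql(1) by simp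
        note gg = g[OF this, of "a / 2 ^ Suc j"]
        have "nW (s (Suc j) - s j) \<le> C * nX (x - q (s j))"
          using gg a by (simp add: sS)
        also have "\<dots> \<le> C * (a / 2 ^ j)" using s \<open>C \<ge> 0\<close> by (intro mult_left_mono) auto
        finally show ?thesis by simp
      qed
      \<comment> \<open>The right-hand side is the exact sum of the geometric bounds on the
        increments from k to k + i; keeping the subtracted term lets the induction close.\<close>
      have tail: "nW (s (k + i) - s k) \<le> 2 * C * a / 2 ^ k - 2 * C * a / 2 ^ (k + i)" for k i
      proof (induction i)
        case (Suc i)
        have "nW (s (k + Suc i) - s k) \<le> nW (s (Suc (k + i)) - s (k + i)) + nW (s (k + i) - s k)"
          using W.triangle_diff s by simp
        moreover have "2 * C * a / 2 ^ (k + Suc i) = 2 * C * a / 2 ^ (k + i) - C * a / 2 ^ (k + i)"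
          by simp
        ultimately show ?case using Suc step[of "k + i"] by linarith
      qed auto
      have bound: "nW (s j - s k) \<le> 2 * C * a / 2 ^ k" if "k \<le> j" for j k
        using tail[of k "j - k"] that a \<open>C \<ge> 0\<close> by (smt (verit) divide_nonneg_nonneg le_add_diff_inverse mult_nonneg_nonneg zero_le_power)
      have lim: "(\<lambda>k. c / 2 ^ k) \<longlonglongrightarrow> 0" for c :: real
        using tendsto_mult_right_zero[OF LIMSEQ_realpow_zero[of "1/2::real"], of c]
        by (simp add: power_divide)
      obtain l where l: "l \<in> W" "(\<lambda>k. nW (s k - l)) \<longlonglongrightarrow> 0"
      proof (rule W.complete[of s])
        fix e :: real assume "e > 0"
        then obtain N where N: "2 * C * a / 2 ^ k < e" if "k \<ge> N" for k
          using order_tendstoD(2)[OF lim, of e] by (auto simp: eventually_sequentially)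
        show "\<exists>N. \<forall>j\<ge>N. \<forall>k\<ge>N. nW (s j - s k) < e"
        proof (intro exI allI impI)
          fix j k assume jk: "j \<ge> N" "k \<ge> N"
          show "nW (s j - s k) < e"
            using bound[of k j] bound[of j k] N[OF jk(1)] N[OF jk(2)] W.norm_minus_commute[of "s j" "s k"] s
            by (cases "k \<le> j") auto
        qed
      qed (use s in auto)
      have "nX (x - q l) \<le> 0"
      proof (rule LIMSEQ_le_const)
        show "(\<lambda>k. a / 2 ^ k + Q * nW (s k - l)) \<longlonglongrightarrow> 0"
          using tendsto_add[OF lim[of a] tendsto_mult_right_zero[OF l(2), of Q]] by simp
        have "nX (x - q l) \<le> a / 2 ^ k + Q * nW (s k - l)" for k
        proof -
          have "nX (x - q l) \<le> nX (x - q (s k)) + nX (q (s k) - q l)"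
            using X.triangle_diff xX ql(1) s l by simp
          also have "nX (q (s k) - q l) \<le> Q * nW (s k - l)"
            using Q[of "s k - l"] ql(5)[of "s k" l] s l by simp
          finally show ?thesis using s[of k] by linarith
        qed
        then show "\<exists>N. \<forall>k\<ge>N. nX (x - q l) \<le> a / 2 ^ k + Q * nW (s k - l)" by blast
      qed
      then have "q l = x"
        using X.nonneg[of "x - q l"] X.eq_0_iff[of "x - q l"] xX ql(1) l by simp
      then have "l = w" using inj_onD[OF inj, of l w] l w by (simp add: x_def)
      \<comment> \<open>As \<open>s 0 = 0\<close>, the estimate \<open>bound\<close> started at
        index 0 controls every partial sum, and the bound passes to the limit.\<close>
      have "nW w \<le> 2 * C * a"
      proof (rule LIMSEQ_le_const)
        show "(\<lambda>k. nW (s k - l) + 2 * C * a) \<longlonglongrightarrow> 2 * C * a"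
          using tendsto_add[OF l(2) tendsto_const[of "2 * C * a"]] by simp
        have "nW w \<le> nW (s k - l) + 2 * C * a" for k
          using W.triangle_diff[of l "s k" 0] W.norm_minus_commute[of l "s k"] bound[of 0 k] s[of k] l \<open>l = w\<close>
          by (simp add: s0)
        then show "\<exists>N. \<forall>k\<ge>N. nW w \<le> nW (s k - l) + 2 * C * a" by blast
      qed
      then show ?thesis by (simp add: a_def x_def)
    qed
  qed
qed

section \<open>Spaces of bounded functions\<close>

text \<open>With T all of nat this is l_inf; with T the cube it is the ambient space of C(2^K). The
  value 0 off T makes \<open>sup_norm T\<close> definite and agrees with the normalisation in
  \<open>CK_set\<close>.\<close>

definition bounded_fun :: "'a set \<Rightarrow> ('a \<Rightarrow> real) set" where
  "bounded_fun T = {f. bdd_above ((\<lambda>x. \<bar>f x\<bar>) ` T) \<and> (\<forall>x. x \<notin> T \<longrightarrow> f x = 0)}"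

definition sup_norm :: "'a set \<Rightarrow> ('a \<Rightarrow> real) \<Rightarrow> real" where
  "sup_norm T f = (SUP x\<in>T. \<bar>f x\<bar>)"

lemma c0_norm_eq: "c0_norm = sup_norm UNIV"
  by (simp add: fun_eq_iff c0_norm_def sup_norm_def)

lemma CK_norm_eq: "CK_norm K = sup_norm (topspace (cantor_cube K))"
  by (simp add: fun_eq_iff CK_norm_def sup_norm_def)

lemma bounded_funI:
  "(\<And>x. x \<in> T \<Longrightarrow> \<bar>f x\<bar> \<le> B) \<Longrightarrow> (\<And>x. x \<notin> T \<Longrightarrow> f x = 0) \<Longrightarrow> f \<in> bounded_fun T"
  by (auto simp: bounded_fun_def bdd_above_def)

lemma abs_le_sup_norm: "f \<in> bounded_fun T \<Longrightarrow> x \<in> T \<Longrightarrow> \<bar>f x\<bar> \<le> sup_norm T f"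
  by (auto simp: bounded_fun_def sup_norm_def intro: cSUP_upper)

lemma sup_norm_le: "T \<noteq> {} \<Longrightarrow> (\<And>x. x \<in> T \<Longrightarrow> \<bar>f x\<bar> \<le> B) \<Longrightarrow> sup_norm T f \<le> B"
  by (auto simp: sup_norm_def intro: cSUP_least)

lemma bounded_fun_add: "f \<in> bounded_fun T \<Longrightarrow> g \<in> bounded_fun T \<Longrightarrow> f + g \<in> bounded_fun T"
  by (rule bounded_funI[where B = "sup_norm T f + sup_norm T g"])
    (auto simp: bounded_fun_def intro!: order_trans[OF abs_triangle_ineq] add_mono abs_le_sup_norm)

lemma bounded_fun_scale: "f \<in> bounded_fun T \<Longrightarrow> c *\<^sub>R f \<in> bounded_fun T"
  by (rule bounded_funI[where B = "\<bar>c\<bar> * sup_norm T f"])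
    (auto simp: scaleR_fun_def abs_mult bounded_fun_def intro!: mult_left_mono abs_le_sup_norm)

lemma subspace_bounded_fun: "subspace (bounded_fun T)"
  by (auto simp: subspace_def bounded_fun_add bounded_fun_scale intro: bounded_funI[where B = 0])

lemma banach_on_bounded_fun:
  assumes T: "T \<noteq> {}"
  shows "banach_on (bounded_fun T) (sup_norm T)"
  unfolding banach_on_def
proof (intro conjI ballI allI impI)
  show "subspace (bounded_fun T)" by (rule subspace_bounded_fun)
next
  fix f assume f: "f \<in> bounded_fun T"
  show nonneg: "0 \<le> sup_norm T f"
    using T abs_le_sup_norm[OF f] by fastforce
  show "sup_norm T f = 0 \<longleftrightarrow> f = 0"
  proof
    assume "sup_norm T f = 0"
    then show "f = 0"
      using abs_le_sup_norm[OF f] f by (force simp: fun_eq_iff bounded_fun_def)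
  next
    assume "f = 0"
    then show "sup_norm T f = 0"
      using nonneg sup_norm_le[OF T, of f 0] by simp
  qed
next
  have le: "sup_norm T (c *\<^sub>R f) \<le> \<bar>c\<bar> * sup_norm T f" if "f \<in> bounded_fun T" for f c
    using that T by (auto simp: scaleR_fun_def abs_mult intro!: sup_norm_le mult_left_mono abs_le_sup_norm)
  fix f :: "'a \<Rightarrow> real" and c :: real assume f: "f \<in> bounded_fun T"
  show "sup_norm T (c *\<^sub>R f) = \<bar>c\<bar> * sup_norm T f"
  proof (cases "c = 0")
    case True
    obtain x where "x \<in> T" using T by blast
    then have "0 \<le> sup_norm T (c *\<^sub>R f)"
      using abs_le_sup_norm[OF bounded_fun_scale[OF f, of c]] by fastforce
    then show ?thesis using le[OF f, of c] True by simp
  next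
    case False
    \<comment> \<open>The reverse inequality is \<open>le\<close> for the inverse scalar, applied to
      the scaled function.\<close>
    have "\<bar>c\<bar> * sup_norm T f = \<bar>c\<bar> * sup_norm T (inverse c *\<^sub>R (c *\<^sub>R f))"
      using False by simp
    also have "\<dots> \<le> \<bar>c\<bar> * (\<bar>inverse c\<bar> * sup_norm T (c *\<^sub>R f))"
      by (intro mult_left_mono le bounded_fun_scale f) auto
    also have "\<dots> = sup_norm T (c *\<^sub>R f)"
      using False by (simp add: abs_inverse)
    finally show ?thesis using le[OF f, of c] by simp
  qed
next
  fix f g :: "'a \<Rightarrow> real" assume fg: "f \<in> bounded_fun T" "g \<in> bounded_fun T"
  show "sup_norm T (f + g) \<le> sup_norm T f + sup_norm T g"
    using fg T by (auto intro!: sup_norm_le order_trans[OF abs_triangle_ineq] add_mono abs_le_sup_norm)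
next
  fix s :: "nat \<Rightarrow> 'a \<Rightarrow> real"
  assume "(\<forall>k. s k \<in> bounded_fun T) \<and> (\<forall>e>0. \<exists>N. \<forall>j\<ge>N. \<forall>k\<ge>N. sup_norm T (s j - s k) < e)"
  then have s: "\<And>k. s k \<in> bounded_fun T"
    and C: "\<And>e. e > 0 \<Longrightarrow> \<exists>N. \<forall>j\<ge>N. \<forall>k\<ge>N. sup_norm T (s j - s k) < e" by auto
  have diff: "\<bar>s j x - s k x\<bar> \<le> sup_norm T (s j - s k)" if "x \<in> T" for j k x
    using abs_le_sup_norm[OF subspace_diff[OF subspace_bounded_fun s s] that, of j k] by simp
  have "convergent (\<lambda>k. s k x)" for x
  proof (cases "x \<in> T")
    case True
    have "Cauchy (\<lambda>k. s k x)"
      unfolding Cauchy_def dist_real_def using C diff[OF True] by (meson order.strict_trans1)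
    then show ?thesis by (simp add: Cauchy_convergent_iff)
  next
    case False
    then have "(\<lambda>k. s k x) = (\<lambda>k. 0)" using s by (auto simp: bounded_fun_def)
    then show ?thesis by (simp add: convergent_const)
  qed
  then obtain l where l: "\<And>x. (\<lambda>k. s k x) \<longlonglongrightarrow> l x"
    unfolding convergent_def by metis
  \<comment> \<open>Letting j tend to infinity in the Cauchy estimate turns pointwise into uniform
    convergence, at the price of a weak inequality.\<close>
  have close: "\<exists>N. \<forall>k\<ge>N. \<forall>x\<in>T. \<bar>s k x - l x\<bar> \<le> e" if e: "e > 0" for e
  proof -
    obtain N where N: "\<And>j k. j \<ge> N \<Longrightarrow> k \<ge> N \<Longrightarrow> sup_norm T (s j - s k) < e"
      using C[OF e] by blast
    have "\<bar>s k x - l x\<bar> \<le> e" if "k \<ge> N" "x \<in> T" for k x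
    proof (rule LIMSEQ_le_const2)
      show "(\<lambda>j. \<bar>s k x - s j x\<bar>) \<longlonglongrightarrow> \<bar>s k x - l x\<bar>"
        by (intro tendsto_intros l)
      show "\<exists>M. \<forall>j\<ge>M. \<bar>s k x - s j x\<bar> \<le> e"
        using N[OF that(1)] diff[OF that(2), of k] by (meson less_imp_le order_trans)
    qed
    then show ?thesis by blast
  qed
  have l0: "l x = 0" if "x \<notin> T" for x
    using LIMSEQ_unique[OF l[of x]] s that by (auto simp: bounded_fun_def)
  obtain N where N: "\<And>x. x \<in> T \<Longrightarrow> \<bar>s N x - l x\<bar> \<le> 1"
    using close[of 1] by auto
  have "l \<in> bounded_fun T"
  proof (rule bounded_funI[where B = "sup_norm T (s N) + 1"])
    show "\<bar>l x\<bar> \<le> sup_norm T (s N) + 1" if "x \<in> T" for x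
      using N[OF that] abs_le_sup_norm[OF s that, of N] by linarith
  qed (rule l0)
  moreover have "(\<lambda>k. sup_norm T (s k - l)) \<longlonglongrightarrow> 0"
  proof (rule LIMSEQ_I)
    fix r :: real assume "r > 0"
    then obtain N where N: "\<And>k x. k \<ge> N \<Longrightarrow> x \<in> T \<Longrightarrow> \<bar>s k x - l x\<bar> \<le> r/2"
      using close[of "r/2"] by auto
    have "norm (sup_norm T (s k - l) - 0) < r" if "k \<ge> N" for k
    proof -
      have "sup_norm T (s k - l) \<le> r/2"
        using N[OF that] by (intro sup_norm_le T) auto
      moreover obtain x where "x \<in> T" using T by blast
      then have "0 \<le> sup_norm T (s k - l)"
        using abs_le_sup_norm[OF subspace_diff[OF subspace_bounded_fun s \<open>l \<in> bounded_fun T\<close>], of x k]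
        by simp
      ultimately show ?thesis using \<open>r > 0\<close> by simp
    qed
    then show "\<exists>N. \<forall>k\<ge>N. norm (sup_norm T (s k - l) - 0) < r" by blast
  qed
  ultimately show "\<exists>l\<in>bounded_fun T. (\<lambda>k. sup_norm T (s k - l)) \<longlonglongrightarrow> 0" by blast
qed

lemma sup_norm_tendsto_0D:
  assumes "(\<lambda>k. sup_norm T (s k - l)) \<longlonglongrightarrow> 0" "\<And>k. s k \<in> bounded_fun T" "l \<in> bounded_fun T" "e > 0"
  obtains k where "\<And>x. x \<in> T \<Longrightarrow> \<bar>s k x - l x\<bar> < e"
proof -
  obtain k where "sup_norm T (s k - l) < e"
    using order_tendstoD(2)[OF assms(1,4)] by (auto simp: eventually_sequentially)
  then show thesis
    using abs_le_sup_norm[OF subspace_diff[OF subspace_bounded_fun assms(2,3)], of _ k]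
    by (intro that[of k]) fastforce
qed

lemma banach_on_Times:
  assumes V: "banach_on V n" and W: "banach_on W m"
  shows "banach_on (V \<times> W) (\<lambda>z. max (n (fst z)) (m (snd z)))"
proof -
  interpret V: banach_space V n by unfold_locales (rule V)
  interpret W: banach_space W m by unfold_locales (rule W)
  show ?thesis
    unfolding banach_on_def
  proof (intro conjI ballI allI impI)
    show "subspace (V \<times> W)" by (intro subspace_Times V.subspace W.subspace)
  next
    fix z assume "z \<in> V \<times> W"
    then show "0 \<le> max (n (fst z)) (m (snd z))" "max (n (fst z)) (m (snd z)) = 0 \<longleftrightarrow> z = 0"
      using V.nonneg[of "fst z"] W.nonneg[of "snd z"] V.eq_0_iff[of "fst z"] W.eq_0_iff[of "snd z"]
      by (auto simp: max_def prod_eq_iff mem_Times_iff)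
    fix c
    show "max (n (fst (c *\<^sub>R z))) (m (snd (c *\<^sub>R z))) = \<bar>c\<bar> * max (n (fst z)) (m (snd z))"
      using \<open>z \<in> V \<times> W\<close> by (simp add: mem_Times_iff V.scale W.scale max_mult_distrib_left)
  next
    fix z z' assume "z \<in> V \<times> W" "z' \<in> V \<times> W"
    then show "max (n (fst (z + z'))) (m (snd (z + z')))
        \<le> max (n (fst z)) (m (snd z)) + max (n (fst z')) (m (snd z'))"
      using order_trans[OF V.triangle add_mono[OF max.cobounded1 max.cobounded1]]
        order_trans[OF W.triangle add_mono[OF max.cobounded2 max.cobounded2]]
      by (simp only: mem_Times_iff fst_add snd_add max.bounded_iff)
  next
    fix s :: "nat \<Rightarrow> 'a \<times> 'b"
    assume "(\<forall>k. s k \<in> V \<times> W) \<and>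
      (\<forall>e>0. \<exists>N. \<forall>j\<ge>N. \<forall>k\<ge>N. max (n (fst (s j - s k))) (m (snd (s j - s k))) < e)"
    then have s: "\<And>k. fst (s k) \<in> V" "\<And>k. snd (s k) \<in> W"
      and C: "\<And>e. e > 0 \<Longrightarrow> \<exists>N. \<forall>j\<ge>N. \<forall>k\<ge>N. n (fst (s j) - fst (s k)) < e \<and> m (snd (s j) - snd (s k)) < e"
      by (auto simp: mem_Times_iff)
    have C1: "\<exists>N. \<forall>j\<ge>N. \<forall>k\<ge>N. n (fst (s j) - fst (s k)) < e"
      and C2: "\<exists>N. \<forall>j\<ge>N. \<forall>k\<ge>N. m (snd (s j) - snd (s k)) < e" if "e > 0" for e
      using C[OF that] by metis+
    obtain l where l: "l \<in> V" "(\<lambda>k. n (fst (s k) - l)) \<longlonglongrightarrow> 0"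
      using V.complete[of "\<lambda>k. fst (s k)", OF s(1) C1] .
    obtain l' where l': "l' \<in> W" "(\<lambda>k. m (snd (s k) - l')) \<longlonglongrightarrow> 0"
      using W.complete[of "\<lambda>k. snd (s k)", OF s(2) C2] .
    have "(\<lambda>k. max (n (fst (s k - (l, l')))) (m (snd (s k - (l, l'))))) \<longlonglongrightarrow> 0"
      using tendsto_max[OF l(2) l'(2)] by simp
    then show "\<exists>l\<in>V \<times> W. (\<lambda>k. max (n (fst (s k - l))) (m (snd (s k - l)))) \<longlonglongrightarrow> 0"
      using l l' by blast
  qed
qed

section \<open>The Banach space c_0\<close>

lemma c0_set_subset: "c0_set \<subseteq> bounded_fun UNIV"
proof
  fix s assume "s \<in> c0_set"
  then have "Bseq s" by (auto simp: c0_set_def intro: convergent_imp_Bseq convergentI)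
  then obtain B where "\<And>k. \<bar>s k\<bar> \<le> B" by (auto simp: Bseq_def)
  then show "s \<in> bounded_fun UNIV" by (auto intro: bounded_funI)
qed

lemma banach_on_c0: "banach_on c0_set c0_norm"
proof -
  interpret l: banach_space "bounded_fun (UNIV :: nat set)" "sup_norm UNIV"
    by unfold_locales (rule banach_on_bounded_fun, simp)
  show ?thesis
    unfolding c0_norm_eq
  proof (rule l.banach_on_closed_subspace)
    show "subspace c0_set"
      using tendsto_add[of _ "0::real" _ _ 0] tendsto_mult_right_zero[where 'a = real]
      by (fastforce simp: subspace_def c0_set_def scaleR_fun_def plus_fun_def zero_fun_def)
    show "c0_set \<subseteq> bounded_fun UNIV" by (rule c0_set_subset)
    show "closed_in_norm (bounded_fun UNIV) (sup_norm UNIV) c0_set"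
      unfolding closed_in_norm_def
    proof (intro allI impI, elim conjE)
      fix s and l :: "nat \<Rightarrow> real"
      assume s: "\<forall>k. s k \<in> c0_set" and l: "l \<in> bounded_fun UNIV" "(\<lambda>k. sup_norm UNIV (s k - l)) \<longlonglongrightarrow> 0"
      have "l \<longlonglongrightarrow> 0"
      proof (rule LIMSEQ_I)
        fix r :: real assume "r > 0"
        obtain k where k: "\<And>x. \<bar>s k x - l x\<bar> < r/2"
          by (rule sup_norm_tendsto_0D[OF l(2) _ l(1), of "r/2"])
            (use s c0_set_subset \<open>r > 0\<close> in auto)
        have "s k \<longlonglongrightarrow> 0" using s by (simp add: c0_set_def)
        from LIMSEQ_D[OF this, of "r/2"] obtain N where "\<And>x. x \<ge> N \<Longrightarrow> \<bar>s k x\<bar> < r/2"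
          using \<open>r > 0\<close> by auto
        then have "\<bar>l x\<bar> < r" if "x \<ge> N" for x
          using k[of x] that \<open>r > 0\<close> by (smt (verit) field_sum_of_halves)
        then show "\<exists>N. \<forall>x\<ge>N. norm (l x - 0) < r" by auto
      qed
      then show "l \<in> c0_set" by (simp add: c0_set_def)
    qed
  qed
qed

section \<open>The Banach space C(2^K)\<close>

lemma topspace_cantor_cube: "topspace (cantor_cube K) = extensional K"
  by (simp add: cantor_cube_def PiE_def)

lemma CK_set_subset: "CK_set K \<subseteq> bounded_fun (topspace (cantor_cube K))"
proof
  fix f assume "f \<in> CK_set K"
  then have f: "continuous_map (cantor_cube K) euclideanreal f" "\<And>x. x \<notin> topspace (cantor_cube K) \<Longrightarrow> f x = 0"
    by (auto simp: CK_set_def)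
  have "compact_space (cantor_cube K)"
    unfolding cantor_cube_def by (simp add: compact_space_product_topology compact_space_discrete_topology)
  then have "compact (f ` topspace (cantor_cube K))"
    using image_compactin[OF _ f(1)] by (simp add: compact_space_def)
  then obtain B where "\<And>x. x \<in> topspace (cantor_cube K) \<Longrightarrow> \<bar>f x\<bar> \<le> B"
    using compact_imp_bounded bounded_iff by (metis image_eqI real_norm_def)
  with f(2) show "f \<in> bounded_fun (topspace (cantor_cube K))"
    by (auto intro: bounded_funI)
qed

lemma banach_on_CK: "banach_on (CK_set K) (CK_norm K)"
proof -
  let ?T = "topspace (cantor_cube K)"
  have T: "?T \<noteq> {}" by (auto simp: topspace_cantor_cube extensional_def)
  interpret l: banach_space "bounded_fun ?T" "sup_norm ?T"
    by unfold_locales (rule banach_on_bounded_fun[OF T])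
  show ?thesis
    unfolding CK_norm_eq
  proof (rule l.banach_on_closed_subspace)
    show "subspace (CK_set K)"
      by (auto simp: subspace_def CK_set_def scaleR_fun_def plus_fun_def zero_fun_def intro!: continuous_intros)
    show "CK_set K \<subseteq> bounded_fun ?T" by (rule CK_set_subset)
    show "closed_in_norm (bounded_fun ?T) (sup_norm ?T) (CK_set K)"
      unfolding closed_in_norm_def
    proof (intro allI impI, elim conjE)
      fix s l
      assume s: "\<forall>k. s k \<in> CK_set K" and l: "l \<in> bounded_fun ?T" "(\<lambda>k. sup_norm ?T (s k - l)) \<longlonglongrightarrow> 0"
      have "continuous_map (cantor_cube K) Met_TC.mtopology l"
      proof (rule Met_TC.continuous_map_uniform_limit_alt[where F = sequentially and f = s])
        show "\<forall>\<^sub>F k in sequentially. continuous_map (cantor_cube K) Met_TC.mtopology (s k)"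
          using s by (simp add: CK_set_def)
        fix e :: real assume "e > 0"
        from order_tendstoD(2)[OF l(2) this]
        show "\<forall>\<^sub>F k in sequentially. \<forall>x\<in>?T. dist (s k x) (l x) < e"
        proof eventually_elim
          case (elim k)
          have "s k \<in> bounded_fun ?T" using s CK_set_subset by blast
          from abs_le_sup_norm[OF subspace_diff[OF subspace_bounded_fun this l(1)]] elim
          show ?case by (force simp: dist_real_def)
        qed
      qed auto
      then show "l \<in> CK_set K"
        using l(1) by (simp add: CK_set_def bounded_fun_def)
    qed
  qed
qed

section \<open>Twisted sums from almost disjoint families\<close>

text \<open>The pullback of l_inf -> l_inf / c_0 along the glued operator, written without the
  quotient. The first condition fixes s along each \<open>A l\<close> up to a null sequence; the
  second makes s small off finitely many of the \<open>A l\<close>. Together they determine s modulo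
  c_0.\<close>

definition ad_twist :: "('l \<Rightarrow> nat set) \<Rightarrow> ('l \<Rightarrow> 'x \<Rightarrow> real) \<Rightarrow> 'x set \<Rightarrow> ((nat \<Rightarrow> real) \<times> 'x) set" where
  "ad_twist A \<phi> X = {(s, x). s \<in> bounded_fun UNIV \<and> x \<in> X \<and>
     (\<forall>l. \<forall>e>0. \<forall>\<^sub>F k in sequentially. k \<in> A l \<longrightarrow> \<bar>s k - \<phi> l x\<bar> < e) \<and>
     (\<forall>e>0. \<exists>F. finite F \<and> (\<forall>\<^sub>F k in sequentially. k \<notin> (\<Union>l\<in>F. A l) \<longrightarrow> \<bar>s k\<bar> < e))}"

lemma ad_twistI:
  assumes "s \<in> bounded_fun UNIV" "x \<in> X"
    and "\<And>l e. e > 0 \<Longrightarrow> \<forall>\<^sub>F k in sequentially. k \<in> A l \<longrightarrow> \<bar>s k - \<phi> l x\<bar> < e"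
    and "\<And>e. e > 0 \<Longrightarrow> \<exists>F. finite F \<and> (\<forall>\<^sub>F k in sequentially. k \<notin> (\<Union>l\<in>F. A l) \<longrightarrow> \<bar>s k\<bar> < e)"
  shows "(s, x) \<in> ad_twist A \<phi> X"
  using assms by (simp add: ad_twist_def)

lemma ad_twistD:
  assumes "(s, x) \<in> ad_twist A \<phi> X"
  shows "s \<in> bounded_fun UNIV" "x \<in> X"
    and "e > 0 \<Longrightarrow> \<forall>\<^sub>F k in sequentially. k \<in> A l \<longrightarrow> \<bar>s k - \<phi> l x\<bar> < e"
    and "e > 0 \<Longrightarrow> \<exists>F. finite F \<and> (\<forall>\<^sub>F k in sequentially. k \<notin> (\<Union>l\<in>F. A l) \<longrightarrow> \<bar>s k\<bar> < e)"
  using assms by (simp_all add: ad_twist_def)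

definition twist_norm :: "('x \<Rightarrow> real) \<Rightarrow> (nat \<Rightarrow> real) \<times> 'x \<Rightarrow> real" where
  "twist_norm nX z = max (sup_norm UNIV (fst z)) (nX (snd z))"

text \<open>A single constant \<open>c\<close> for all l makes the functionals equicontinuous. This
  keeps the lifts bounded and lets the conditions of \<open>ad_twist\<close> survive norm
  limits.\<close>

locale null_functionals = banach_space X nX
  for X :: "'x::real_vector set" and nX :: "'x \<Rightarrow> real" +
  fixes \<phi> :: "'l \<Rightarrow> 'x \<Rightarrow> real" and c :: real and A :: "'l \<Rightarrow> nat set"
  assumes phi_add: "x \<in> X \<Longrightarrow> y \<in> X \<Longrightarrow> \<phi> l (x + y) = \<phi> l x + \<phi> l y"
    and phi_scale: "x \<in> X \<Longrightarrow> \<phi> l (a *\<^sub>R x) = a * \<phi> l x"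
    and phi_bounded: "x \<in> X \<Longrightarrow> \<bar>\<phi> l x\<bar> \<le> c * nX x"
    and phi_null: "x \<in> X \<Longrightarrow> e > 0 \<Longrightarrow> finite {l. e \<le> \<bar>\<phi> l x\<bar>}"
    and almost_disjoint: "l \<noteq> l' \<Longrightarrow> finite (A l \<inter> A l')"
begin

lemma phi_0 [simp]: "\<phi> l 0 = 0"
  using phi_scale[of 0 l 0] by simp

lemma phi_diff: "x \<in> X \<Longrightarrow> y \<in> X \<Longrightarrow> \<phi> l (x - y) = \<phi> l x - \<phi> l y"
  using phi_add[of x "-1 *\<^sub>R y"] phi_scale[of y l "-1"] closed(4)[of y "-1"] by simp

section \<open>The pullback is a Banach space\<close>

lemma subspace_ad_twist: "subspace (ad_twist A \<phi> X)"
  unfolding subspace_def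
proof (intro conjI ballI allI)
  have "(0, 0) \<in> ad_twist A \<phi> X"
    by (rule ad_twistI) (auto intro: subspace_0[OF subspace_bounded_fun] exI[of _ "{}"])
  then show "0 \<in> ad_twist A \<phi> X" by (simp add: zero_prod_def)
next
  fix z z' assume z: "z \<in> ad_twist A \<phi> X" "z' \<in> ad_twist A \<phi> X"
  obtain s x t y where eq: "z = (s, x)" "z' = (t, y)" by (cases z, cases z')
  note s = ad_twistD[OF z(1)[unfolded eq]] and t = ad_twistD[OF z(2)[unfolded eq]]
  have "(s + t, x + y) \<in> ad_twist A \<phi> X"
  proof (rule ad_twistI)
    fix l and e :: real assume "e > 0"
    then have "e/2 > 0" by simp
    from s(3)[OF this, of l] t(3)[OF this, of l]
    show "\<forall>\<^sub>F k in sequentially. k \<in> A l \<longrightarrow> \<bar>(s + t) k - \<phi> l (x + y)\<bar> < e"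
    proof eventually_elim
      case (elim k)
      show ?case
      proof
        assume "k \<in> A l"
        with elim show "\<bar>(s + t) k - \<phi> l (x + y)\<bar> < e"
          unfolding plus_fun_apply phi_add[OF s(2) t(2)] by linarith
      qed
    qed
  next
    fix e :: real assume "e > 0"
    then have "e/2 > 0" by simp
    from s(4)[OF this] t(4)[OF this] obtain F G where
      F: "finite F" "\<forall>\<^sub>F k in sequentially. k \<notin> (\<Union>l\<in>F. A l) \<longrightarrow> \<bar>s k\<bar> < e/2" and
      G: "finite G" "\<forall>\<^sub>F k in sequentially. k \<notin> (\<Union>l\<in>G. A l) \<longrightarrow> \<bar>t k\<bar> < e/2" by blast
    from F(2) G(2) have "\<forall>\<^sub>F k in sequentially. k \<notin> (\<Union>l\<in>F \<union> G. A l) \<longrightarrow> \<bar>(s + t) k\<bar> < e"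
      by eventually_elim auto
    with F G show "\<exists>F. finite F \<and> (\<forall>\<^sub>F k in sequentially. k \<notin> (\<Union>l\<in>F. A l) \<longrightarrow> \<bar>(s + t) k\<bar> < e)"
      by blast
  qed (use s t in \<open>auto intro: bounded_fun_add\<close>)
  then show "z + z' \<in> ad_twist A \<phi> X" by (simp add: eq)
next
  fix a :: real and z assume z: "z \<in> ad_twist A \<phi> X"
  obtain s x where eq: "z = (s, x)" by (cases z)
  note s = ad_twistD[OF z[unfolded eq]]
  \<comment> \<open>The 1 added in the divisor covers the case \<open>a = 0\<close>.\<close>
  have small: "\<bar>a * b\<bar> < e" if "\<bar>b\<bar> < e / (\<bar>a\<bar> + 1)" "e > 0" for b e :: real
  proof -
    have "\<bar>a * b\<bar> \<le> (\<bar>a\<bar> + 1) * \<bar>b\<bar>" by (simp add: abs_mult mult_right_mono)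
    also have "\<dots> < e" using that by (simp add: field_simps)
    finally show ?thesis .
  qed
  have "(a *\<^sub>R s, a *\<^sub>R x) \<in> ad_twist A \<phi> X"
  proof (rule ad_twistI)
    fix l and e :: real assume e: "e > 0"
    then have "e / (\<bar>a\<bar> + 1) > 0" by simp
    from s(3)[OF this, of l]
    show "\<forall>\<^sub>F k in sequentially. k \<in> A l \<longrightarrow> \<bar>(a *\<^sub>R s) k - \<phi> l (a *\<^sub>R x)\<bar> < e"
    proof eventually_elim
      case (elim k)
      then show ?case using small[OF _ e, of "s k - \<phi> l x"]
        by (simp add: phi_scale s scaleR_fun_def right_diff_distrib)
    qed
  next
    fix e :: real assume e: "e > 0"
    then have "e / (\<bar>a\<bar> + 1) > 0" by simp
    from s(4)[OF this] obtain F where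
      F: "finite F" "\<forall>\<^sub>F k in sequentially. k \<notin> (\<Union>l\<in>F. A l) \<longrightarrow> \<bar>s k\<bar> < e / (\<bar>a\<bar> + 1)" by blast
    from F(2) have "\<forall>\<^sub>F k in sequentially. k \<notin> (\<Union>l\<in>F. A l) \<longrightarrow> \<bar>(a *\<^sub>R s) k\<bar> < e"
      by eventually_elim (use small[OF _ e] in \<open>auto simp: scaleR_fun_def\<close>)
    with F show "\<exists>F. finite F \<and> (\<forall>\<^sub>F k in sequentially. k \<notin> (\<Union>l\<in>F. A l) \<longrightarrow> \<bar>(a *\<^sub>R s) k\<bar> < e)"
      by blast
  qed (use s in \<open>auto intro: bounded_fun_scale\<close>)
  then show "a *\<^sub>R z \<in> ad_twist A \<phi> X" by (simp add: eq)
qed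

text \<open>Both conditions tolerate an arbitrary error e, so a limit inherits them from one
  sufficiently close member by splitting e.\<close>

lemma closed_ad_twist:
  "closed_in_norm (bounded_fun UNIV \<times> X) (twist_norm nX) (ad_twist A \<phi> X)"
  unfolding closed_in_norm_def
proof (intro allI impI, elim conjE)
  fix z :: "nat \<Rightarrow> (nat \<Rightarrow> real) \<times> 'x" and w
  assume z: "\<forall>k. z k \<in> ad_twist A \<phi> X" and w: "w \<in> bounded_fun UNIV \<times> X"
    and lim: "(\<lambda>k. twist_norm nX (z k - w)) \<longlonglongrightarrow> 0"
  obtain s x where eq: "w = (s, x)" by (cases w)
  \<comment> \<open>One member of the twisted sum is close both in the sequence and in all
    functionals at once. The 1 added to the modulus of \<open>c\<close> keeps the divisor
    positive.\<close>
  have approx: "\<exists>t y. (t, y) \<in> ad_twist A \<phi> X \<and> (\<forall>k. \<bar>t k - s k\<bar> < e) \<and> (\<forall>l. \<bar>\<phi> l y - \<phi> l x\<bar> < e)"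
    if e: "e > 0" for e
  proof -
    have "e / (\<bar>c\<bar> + 1) > 0" using e by simp
    from eventually_conj[OF order_tendstoD(2)[OF lim e] order_tendstoD(2)[OF lim this]]
    obtain j where j: "twist_norm nX (z j - w) < e" "twist_norm nX (z j - w) < e / (\<bar>c\<bar> + 1)"
      by (auto simp: eventually_sequentially)
    obtain t y where ty: "z j = (t, y)" by (cases "z j")
    have mem: "(t, y) \<in> ad_twist A \<phi> X" using z ty by metis
    note t = ad_twistD[OF mem]
    have n: "sup_norm UNIV (t - s) < e" "nX (y - x) < e / (\<bar>c\<bar> + 1)"
      using j by (simp_all add: twist_norm_def ty eq)
    have "t - s \<in> bounded_fun UNIV"
      using w eq t by (auto intro: subspace_diff[OF subspace_bounded_fun])
    from abs_le_sup_norm[OF this] n(1) have "\<forall>k. \<bar>t k - s k\<bar> < e"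
      by (auto intro: le_less_trans)
    moreover have "\<bar>\<phi> l y - \<phi> l x\<bar> < e" for l
    proof -
      have xy: "x \<in> X" "y \<in> X" using w eq t by auto
      have "\<bar>\<phi> l y - \<phi> l x\<bar> \<le> c * nX (y - x)"
        using phi_bounded[of "y - x" l] xy by (simp add: phi_diff)
      also have "\<dots> \<le> (\<bar>c\<bar> + 1) * nX (y - x)"
        using nonneg[of "y - x"] xy by (intro mult_right_mono) auto
      also have "\<dots> < e" using n(2) by (simp add: field_simps)
      finally show ?thesis .
    qed
    ultimately show ?thesis using mem by blast
  qed
  have "(s, x) \<in> ad_twist A \<phi> X"
  proof (rule ad_twistI)
    fix l and e :: real assume "e > 0"
    then have e: "e/3 > 0" by simp
    obtain t y where t: "(t, y) \<in> ad_twist A \<phi> X" "\<And>k. \<bar>t k - s k\<bar> < e/3" "\<And>l. \<bar>\<phi> l y - \<phi> l x\<bar> < e/3"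
      using approx[OF e] by blast
    from ad_twistD(3)[OF t(1) e, of l]
    show "\<forall>\<^sub>F k in sequentially. k \<in> A l \<longrightarrow> \<bar>s k - \<phi> l x\<bar> < e"
    proof eventually_elim
      case (elim k)
      show ?case
      proof
        assume "k \<in> A l"
        with elim t(2)[of k] t(3)[of l] show "\<bar>s k - \<phi> l x\<bar> < e" by linarith
      qed
    qed
  next
    fix e :: real assume "e > 0"
    then have e: "e/2 > 0" by simp
    obtain t y where t: "(t, y) \<in> ad_twist A \<phi> X" "\<And>k. \<bar>t k - s k\<bar> < e/2"
      using approx[OF e] by blast
    from ad_twistD(4)[OF t(1) e] obtain F where
      F: "finite F" "\<forall>\<^sub>F k in sequentially. k \<notin> (\<Union>l\<in>F. A l) \<longrightarrow> \<bar>t k\<bar> < e/2" by blast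
    from F(2) have "\<forall>\<^sub>F k in sequentially. k \<notin> (\<Union>l\<in>F. A l) \<longrightarrow> \<bar>s k\<bar> < e"
    proof eventually_elim
      case (elim k)
      show ?case
      proof
        assume "k \<notin> (\<Union>l\<in>F. A l)"
        with elim t(2)[of k] show "\<bar>s k\<bar> < e" by linarith
      qed
    qed
    with F show "\<exists>F. finite F \<and> (\<forall>\<^sub>F k in sequentially. k \<notin> (\<Union>l\<in>F. A l) \<longrightarrow> \<bar>s k\<bar> < e)"
      by blast
  qed (use w eq in auto)
  then show "w \<in> ad_twist A \<phi> X" by (simp add: eq)
qed

lemma banach_on_ad_twist: "banach_on (ad_twist A \<phi> X) (twist_norm nX)"
proof -
  interpret P: banach_space "bounded_fun (UNIV :: nat set) \<times> X" "twist_norm nX"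
    unfolding twist_norm_def[abs_def]
    by unfold_locales (intro banach_on_Times banach_on_bounded_fun banach UNIV_not_empty)
  show ?thesis
    by (rule P.banach_on_closed_subspace[OF subspace_ad_twist _ closed_ad_twist])
      (auto simp: ad_twist_def)
qed

section \<open>Exactness: the quotient map is onto and its kernel is c_0\<close>

lemma finite_eventually_notin: "finite B \<Longrightarrow> \<forall>\<^sub>F k in sequentially. k \<notin> (B :: nat set)"
  using finite_nat_set_iff_bounded by (auto simp: eventually_sequentially) (meson leD)

text \<open>Surjectivity of the quotient map. The lift is chosen for each x separately, with no
  linearity in x; a bounded linear choice would split the sequence.\<close>

lemma ad_twist_lift:
  assumes x: "x \<in> X"
  obtains s where "(s, x) \<in> ad_twist A \<phi> X"
proof -
  \<comment> \<open>At k take a value of largest modulus among the l with k in A l: almost disjointness makes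
    it the right one for large k.\<close>
  have "\<exists>v. (v = 0 \<or> (\<exists>l. k \<in> A l \<and> v = \<phi> l x)) \<and> (\<forall>l. k \<in> A l \<longrightarrow> \<bar>\<phi> l x\<bar> \<le> \<bar>v\<bar>)" for k
  proof (cases "\<forall>l. k \<in> A l \<longrightarrow> \<phi> l x = 0")
    case False
    then obtain l where l: "k \<in> A l" "\<bar>\<phi> l x\<bar> > 0" by auto
    \<comment> \<open>Infinitely many \<open>A l'\<close> may contain k, but by
      \<open>phi_null\<close> only finitely many of their functionals reach the nonzero modulus at
      l, so a maximum exists.\<close>
    define L where "L = {l'. k \<in> A l' \<and> \<bar>\<phi> l x\<bar> \<le> \<bar>\<phi> l' x\<bar>}"
    have "finite L"
      by (rule finite_subset[OF _ phi_null[OF x l(2)]]) (auto simp: L_def)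
    moreover have "l \<in> L" using l by (simp add: L_def)
    ultimately have "Max ((\<lambda>l. \<bar>\<phi> l x\<bar>) ` L) \<in> (\<lambda>l. \<bar>\<phi> l x\<bar>) ` L"
      by (intro Max_in) auto
    then obtain m where m: "m \<in> L" "Max ((\<lambda>l. \<bar>\<phi> l x\<bar>) ` L) = \<bar>\<phi> m x\<bar>" by blast
    have m2: "\<bar>\<phi> l' x\<bar> \<le> \<bar>\<phi> m x\<bar>" if "l' \<in> L" for l'
      using \<open>finite L\<close> that by (subst m(2)[symmetric]) simp
    have "\<bar>\<phi> l' x\<bar> \<le> \<bar>\<phi> m x\<bar>" if "k \<in> A l'" for l'
      using m2[of l'] m(1) that by (force simp: L_def)
    then show ?thesis using m(1) by (auto simp: L_def)
  qed auto
  then obtain s where s: "\<And>k. s k = 0 \<or> (\<exists>l. k \<in> A l \<and> s k = \<phi> l x)"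
    and max: "\<And>k l. k \<in> A l \<Longrightarrow> \<bar>\<phi> l x\<bar> \<le> \<bar>s k\<bar>" by metis
  \<comment> \<open>Only finitely many l' have a functional of size at least e at x, and each such
    \<open>A l'\<close> with l' other than l meets \<open>A l\<close> in a finite set.\<close>
  have sep: "\<forall>\<^sub>F k in sequentially. k \<in> A l \<longrightarrow> (\<forall>l'. l' \<noteq> l \<and> e \<le> \<bar>\<phi> l' x\<bar> \<longrightarrow> k \<notin> A l')"
    if "e > 0" for l e
  proof -
    have "finite (\<Union>l'\<in>{l'. e \<le> \<bar>\<phi> l' x\<bar>} - {l}. A l \<inter> A l')"
      using phi_null[OF x that] by (intro finite_UN_I almost_disjoint) auto
    from finite_eventually_notin[OF this] show ?thesis by eventually_elim auto
  qed
  have "(s, x) \<in> ad_twist A \<phi> X"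
  proof (rule ad_twistI)
    have "\<bar>s k\<bar> \<le> c * nX x \<or> s k = 0" for k
      using s[of k] phi_bounded[OF x] by metis
    then show "s \<in> bounded_fun UNIV"
      by (intro bounded_funI[where B = "max 0 (c * nX x)"]) (auto simp: le_max_iff_disj)
  next
    fix l and e :: real assume e: "e > 0"
    \<comment> \<open>If the functional at l vanishes, any competing value below e is harmless.
      Otherwise a competing value below its modulus contradicts the maximality in
      \<open>max\<close>.\<close>
    define d where "d = (if \<phi> l x = 0 then e else \<bar>\<phi> l x\<bar>)"
    have "d > 0" using e by (simp add: d_def)
    from sep[OF this, of l]
    show "\<forall>\<^sub>F k in sequentially. k \<in> A l \<longrightarrow> \<bar>s k - \<phi> l x\<bar> < e"
    proof eventually_elim
      case (elim k)
      show ?case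
      proof
        assume k: "k \<in> A l"
        show "\<bar>s k - \<phi> l x\<bar> < e"
        proof (cases "s k = \<phi> l x")
          case True
          then show ?thesis using e by simp
        next
          case False
          then show ?thesis
          proof (cases "s k = 0")
            case True
            then show ?thesis using max[OF k] e by simp
          next
            case nz: False
            then obtain l' where l': "k \<in> A l'" "s k = \<phi> l' x" using s[of k] by blast
            then have "l' \<noteq> l" using False by auto
            then have "\<bar>s k\<bar> < d" using elim k l' by force
            then show ?thesis using max[OF k] by (auto simp: d_def split: if_splits)
          qed
        qed
      qed
    qed
  next
    fix e :: real assume e: "e > 0"
    have "\<bar>s k\<bar> < e" if "k \<notin> (\<Union>l\<in>{l. e \<le> \<bar>\<phi> l x\<bar>}. A l)" for k
      using s[of k] that e by force
    then show "\<exists>F. finite F \<and> (\<forall>\<^sub>F k in sequentially. k \<notin> (\<Union>l\<in>F. A l) \<longrightarrow> \<bar>s k\<bar> < e)"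
      using phi_null[OF x e] by (intro exI[of _ "{l. e \<le> \<bar>\<phi> l x\<bar>}"]) auto
  qed (rule x)
  then show thesis by (rule that)
qed

text \<open>At x = 0 the sequence is eventually below e on each of the finitely many
  \<open>A l\<close> with l in F, and also off their union, hence everywhere.\<close>

lemma ad_twist_kernel: "(s, 0) \<in> ad_twist A \<phi> X \<longleftrightarrow> s \<in> c0_set"
proof
  assume mem: "(s, 0) \<in> ad_twist A \<phi> X"
  have "s \<longlonglongrightarrow> 0"
  proof (rule tendstoI)
    fix e :: real assume e: "e > 0"
    obtain F where F: "finite F" "\<forall>\<^sub>F k in sequentially. k \<notin> (\<Union>l\<in>F. A l) \<longrightarrow> \<bar>s k\<bar> < e"
      using ad_twistD(4)[OF mem e] by blast
    have "\<forall>\<^sub>F k in sequentially. \<forall>l\<in>F. k \<in> A l \<longrightarrow> \<bar>s k\<bar> < e"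
      using ad_twistD(3)[OF mem e] by (intro eventually_ball_finite[OF F(1)]) simp
    with F(2) show "\<forall>\<^sub>F k in sequentially. dist (s k) 0 < e"
      by eventually_elim auto
  qed
  then show "s \<in> c0_set" by (simp add: c0_set_def)
next
  assume s: "s \<in> c0_set"
  have ev: "\<forall>\<^sub>F k in sequentially. P k \<longrightarrow> \<bar>s k\<bar> < e" if "e > 0" for e P
    using s tendstoD[of s 0 sequentially e] that
    by (auto simp: c0_set_def elim: eventually_mono)
  show "(s, 0) \<in> ad_twist A \<phi> X"
    by (rule ad_twistI) (use s c0_set_subset ev in auto)
qed

lemma twisted_sum_ad_twist:
  "twisted_sum c0_set c0_norm (ad_twist A \<phi> X) (twist_norm nX) X nX (\<lambda>s. (s, 0)) snd"
  unfolding twisted_sum_def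
proof (intro conjI)
  have "0 \<le> sup_norm UNIV s" if "s \<in> bounded_fun UNIV" for s :: "nat \<Rightarrow> real"
    using abs_le_sup_norm[OF that, of 0] by simp
  then show "bounded_linear_on c0_set c0_norm (ad_twist A \<phi> X) (twist_norm nX) (\<lambda>s. (s, 0))"
    using c0_set_subset unfolding bounded_linear_on_def
    by (auto simp: ad_twist_kernel twist_norm_def c0_norm_eq intro!: exI[of _ 1])
  show "bounded_linear_on (ad_twist A \<phi> X) (twist_norm nX) X nX snd"
    unfolding bounded_linear_on_def
    by (auto simp: ad_twist_def twist_norm_def intro!: exI[of _ 1])
  show "snd ` ad_twist A \<phi> X = X"
  proof
    show "X \<subseteq> snd ` ad_twist A \<phi> X"
      using ad_twist_lift by (metis image_eqI snd_conv subsetI)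
  qed (auto simp: ad_twist_def)
  show "(\<lambda>s. (s, 0)) ` c0_set = {z \<in> ad_twist A \<phi> X. snd z = 0}"
    by (force simp: ad_twist_kernel)
qed (auto simp: inj_on_def intro: banach_on_c0 banach_on_ad_twist banach)

end

text \<open>The quotient map restricts to a bijection from the closed complement of its kernel onto
  \<open>X\<close>. The section is the inverse of this bijection: bounded by
  \<open>bounded_inverse\<close>, and linear because the restriction is linear and
  injective.\<close>

lemma trivial_twisted_sum_section:
  assumes ts: "twisted_sum Y nY Z nZ X nX i q" and triv: "trivial_twisted_sum Y Z nZ i"
  obtains C S where "C \<ge> 0" "\<forall>x\<in>X. S x \<in> Z \<and> q (S x) = x \<and> nZ (S x) \<le> C * nX x"
    "\<forall>x\<in>X. \<forall>y\<in>X. S (x + y) = S x + S y" "\<forall>x\<in>X. \<forall>a. S (a *\<^sub>R x) = a *\<^sub>R S x"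
proof -
  from ts have Z: "banach_on Z nZ" and X: "banach_on X nX" and q: "bounded_linear_on Z nZ X nX q"
    and surj: "q ` Z = X" and ker: "i ` Y = {z \<in> Z. q z = 0}"
    by (auto simp: twisted_sum_def)
  interpret Z: banach_space Z nZ by unfold_locales (rule Z)
  interpret X: banach_space X nX by unfold_locales (rule X)
  note ql = bounded_linear_onD[OF q Z.subspace]
  obtain W where W: "subspace W" "W \<subseteq> Z" "closed_in_norm Z nZ W" "i ` Y \<inter> W = {0}"
    "{m + w | m w. m \<in> i ` Y \<and> w \<in> W} = Z"
    using triv unfolding trivial_twisted_sum_def complemented_def by blast
  have BW: "banach_on W nZ" using W by (intro Z.banach_on_closed_subspace)
  have qW: "bounded_linear_on W nZ X nX q"
  proof -
    obtain B where "\<forall>z\<in>Z. nX (q z) \<le> B * nZ z"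
      using q unfolding bounded_linear_on_def by blast
    then show ?thesis
      unfolding bounded_linear_on_def
      by (intro conjI exI[of _ B]) (simp_all add: subsetD[OF W(2)] ql)
  qed
  have inj: "w = w'" if "w \<in> W" "w' \<in> W" "q w = q w'" for w w'
  proof -
    have d: "w - w' \<in> W" using that W(1) by (simp add: subspace_diff)
    have "q (w - w') = 0" using ql(5)[of w w'] that W(2) by auto
    then have "w - w' \<in> i ` Y \<inter> W" using d W(2) ker by auto
    then show ?thesis using W(4) by simp
  qed
  have surjW: "q ` W = X"
  proof
    show "X \<subseteq> q ` W"
    proof
      fix x assume "x \<in> X"
      then obtain z where z: "z \<in> Z" "q z = x" using surj by blast
      then obtain m w where mw: "z = m + w" "m \<in> i ` Y" "w \<in> W" using W(5) by blast
      then have "q z = q w" using ql(2)[of m w] ker W(2) by auto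
      then show "x \<in> q ` W" using z mw by blast
    qed
  qed (use surj W(2) in blast)
  obtain C where C: "C \<ge> 0" "\<And>w. w \<in> W \<Longrightarrow> nZ w \<le> C * nX (q w)"
    using bounded_inverse[OF BW X qW inj_onI surjW] inj by blast
  obtain S where S: "\<And>x. x \<in> X \<Longrightarrow> S x \<in> W" "\<And>x. x \<in> X \<Longrightarrow> q (S x) = x"
    using bchoice[of X "\<lambda>x w. w \<in> W \<and> q w = x"] surjW by blast
  show thesis
  proof (rule that[OF C(1), of S]; intro ballI allI)
    fix x assume x: "x \<in> X"
    show "S x \<in> Z \<and> q (S x) = x \<and> nZ (S x) \<le> C * nX x"
      using C(2)[of "S x"] S[OF x] W(2) by auto
    show "S (a *\<^sub>R x) = a *\<^sub>R S x" for a
      by (intro inj) (simp_all add: S ql subsetD[OF W(2)] subspace_scale[OF W(1)] x)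
    show "S (x + y) = S x + S y" if y: "y \<in> X" for y
      by (intro inj) (simp_all add: S ql subsetD[OF W(2)] subspace_add[OF W(1)] x y)
  qed
qed

section \<open>The Cantor cube\<close>

text \<open>A node of the full binary tree is coded by its height m and the trace of L below m.
  Recording the height keeps nodes with equal traces apart, so every branch is infinite.\<close>

definition branch :: "nat set \<Rightarrow> nat set" where
  "branch L = range (\<lambda>m. prod_encode (m, set_encode (L \<inter> {..<m})))"

lemma infinite_branch: "infinite (branch L)"
  unfolding branch_def by (rule range_inj_infinite) (auto intro: injI)

text \<open>Two branches have no common node above the height of a place where the sets
  differ.\<close>

lemma branch_almost_disjoint:
  assumes "L \<noteq> L'"
  shows "finite (branch L \<inter> branch L')"
proof -
  obtain a where a: "a \<in> L \<longleftrightarrow> a \<notin> L'" using assms by blast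
  have "branch L \<inter> branch L' \<subseteq> (\<lambda>m. prod_encode (m, set_encode (L \<inter> {..<m}))) ` {..a}"
  proof
    fix k assume "k \<in> branch L \<inter> branch L'"
    then obtain m where m: "k = prod_encode (m, set_encode (L \<inter> {..<m}))"
      "set_encode (L \<inter> {..<m}) = set_encode (L' \<inter> {..<m})"
      by (auto simp: branch_def)
    then have "L \<inter> {..<m} = L' \<inter> {..<m}" by (simp add: set_encode_eq)
    then have "m \<le> a" using a by (metis IntE IntI lessThan_iff not_le_imp_less)
    then show "k \<in> (\<lambda>m. prod_encode (m, set_encode (L \<inter> {..<m}))) ` {..a}" using m by blast
  qed
  then show ?thesis by (rule finite_subset) simp
qed

text \<open>The power set of nat embeds into \<open>K\<close>. Sets containing 0 supply the
  \<open>i n\<close>, sets avoiding 0 supply the \<open>j L\<close>, so the two kinds of coordinate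
  never clash.\<close>

lemma continuum_coordinates:
  assumes "\<exists>f :: real \<Rightarrow> 'k. inj f \<and> range f \<subseteq> K"
  obtains i :: "nat \<Rightarrow> 'k" and j :: "nat set \<Rightarrow> 'k"
  where "inj i" "inj j" "range i \<subseteq> K" "range j \<subseteq> K" "\<And>n L. i n \<noteq> j L"
proof -
  obtain f :: "real \<Rightarrow> 'k" where f: "inj f" "range f \<subseteq> K" using assms by blast
  obtain g :: "nat set \<Rightarrow> real" where g: "inj g"
    using nat_sets_eqpoll_reals unfolding eqpoll_def bij_betw_def by blast
  have fg: "f (g A) = f (g B) \<longleftrightarrow> A = B" for A B
    using f(1) g by (simp add: inj_eq)
  show thesis
  proof (rule that[of "\<lambda>n. f (g {0, Suc n})" "\<lambda>L. f (g (Suc ` L))"])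
    show "f (g {0, Suc n}) \<noteq> f (g (Suc ` L))" for n L
      unfolding fg by (metis Suc_neq_Zero imageE insertI1)
    show "inj (\<lambda>L. f (g (Suc ` L)))"
      by (rule injI) (auto simp: fg inj_image_eq_iff)
  qed (use f in \<open>auto intro!: injI simp: fg doubleton_eq_iff\<close>)
qed

definition point :: "'k set \<Rightarrow> 'k set \<Rightarrow> 'k \<Rightarrow> bool" where
  "point K S = restrict (\<lambda>\<kappa>. \<kappa> \<in> S) K"

lemma point_in_cube [simp]: "point K S \<in> topspace (cantor_cube K)"
  by (simp add: topspace_cantor_cube point_def)

lemma point_apply [simp]: "\<kappa> \<in> K \<Longrightarrow> point K S \<kappa> \<longleftrightarrow> \<kappa> \<in> S"
  by (simp add: point_def)

text \<open>A basic neighbourhood of x inside the preimage of the e-ball restricts only finitely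
  many coordinates; these form F.\<close>

lemma CK_finite_dependence:
  assumes f: "f \<in> CK_set K" and x: "x \<in> topspace (cantor_cube K)" and e: "e > 0"
  obtains F where "finite F" "F \<subseteq> K"
    "\<And>y. y \<in> topspace (cantor_cube K) \<Longrightarrow> (\<And>\<kappa>. \<kappa> \<in> F \<Longrightarrow> y \<kappa> = x \<kappa>) \<Longrightarrow> \<bar>f y - f x\<bar> < e"
proof -
  define V where "V = {y \<in> topspace (cantor_cube K). f y \<in> ball (f x) e}"
  have "openin (cantor_cube K) V"
    unfolding V_def by (rule openin_continuous_map_preimage) (use f in \<open>auto simp: CK_set_def\<close>)
  then have "\<forall>y\<in>V. \<exists>U. finite {\<kappa> \<in> K. U \<kappa> \<noteq> UNIV} \<and>
      (\<forall>\<kappa>\<in>K. openin (discrete_topology UNIV) (U \<kappa>)) \<and> y \<in> Pi\<^sub>E K U \<and> Pi\<^sub>E K U \<subseteq> V"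
    by (simp only: cantor_cube_def openin_product_topology_alt topspace_discrete_topology)
  moreover have "x \<in> V" using x e by (simp add: V_def)
  ultimately obtain U where U: "finite {\<kappa> \<in> K. U \<kappa> \<noteq> UNIV}" "x \<in> Pi\<^sub>E K U" "Pi\<^sub>E K U \<subseteq> V"
    by meson
  show thesis
  proof (rule that[OF U(1)])
    fix y assume y: "y \<in> topspace (cantor_cube K)" "\<And>\<kappa>. \<kappa> \<in> {\<kappa> \<in> K. U \<kappa> \<noteq> UNIV} \<Longrightarrow> y \<kappa> = x \<kappa>"
    have "y \<in> Pi\<^sub>E K U"
    proof (rule PiE_I)
      fix \<kappa> assume "\<kappa> \<in> K"
      then show "y \<kappa> \<in> U \<kappa>"
        using y(2)[of \<kappa>] U(2) by (cases "U \<kappa> = UNIV") (auto simp: PiE_iff)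
    qed (use y(1) in \<open>auto simp: topspace_cantor_cube extensional_def\<close>)
    then show "\<bar>f y - f x\<bar> < e" using U(3) by (auto simp: V_def dist_real_def abs_minus_commute)
  qed auto
qed

lemma continuous_map_coordinate:
  assumes "\<kappa> \<in> K"
  shows "continuous_map (cantor_cube K) euclideanreal (\<lambda>x. of_bool (x \<kappa>))"
proof -
  have "continuous_map (cantor_cube K) (discrete_topology UNIV) (\<lambda>x. x \<kappa>)"
    unfolding cantor_cube_def by (rule continuous_map_product_projection[OF assms])
  from continuous_map_compose[OF this, of euclideanreal of_bool] show ?thesis
    by (simp add: o_def)
qed

text \<open>The coordinates \<open>i n\<close> cut out the disjoint clopen sets
  \<open>cyl n\<close>, and \<open>j L\<close> is the coordinate reserved for the functional with
  index L. As they are distinct, flipping \<open>j L\<close> does not leave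
  \<open>cyl n\<close>.\<close>

locale cube_coordinates =
  fixes K :: "'k set" and i :: "nat \<Rightarrow> 'k" and j :: "nat set \<Rightarrow> 'k"
  assumes inj_i: "inj i" and inj_j: "inj j" and i_in: "i n \<in> K" and j_in: "j L \<in> K"
    and i_neq_j: "i n \<noteq> j L"
begin

definition jump :: "nat \<Rightarrow> nat set \<Rightarrow> (('k \<Rightarrow> bool) \<Rightarrow> real) \<Rightarrow> real" where
  "jump n L f = f (point K {i n, j L}) - f (point K {i n})"

text \<open>The points with support i n converge to 0, so continuity at countably many points
  suffices for uniformity in n.\<close>
lemma jump_null:
  assumes f: "f \<in> CK_set K" and e: "e > 0"
  shows "finite {L. \<exists>n. e \<le> \<bar>jump n L f\<bar>}"
proof -
  have "e/2 > 0" using e by simp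
  from CK_finite_dependence[OF f point_in_cube this, of "{}"]
  obtain F where F: "finite F"
    "\<And>y. y \<in> topspace (cantor_cube K) \<Longrightarrow> (\<And>\<kappa>. \<kappa> \<in> F \<Longrightarrow> y \<kappa> = point K {} \<kappa>) \<Longrightarrow> \<bar>f y - f (point K {})\<bar> < e/2"
    and FK: "F \<subseteq> K" by metis
  have "\<exists>G. finite G \<and> G \<subseteq> K \<and> (\<forall>y \<in> topspace (cantor_cube K).
      (\<forall>\<kappa>\<in>G. y \<kappa> = point K {i n} \<kappa>) \<longrightarrow> \<bar>f y - f (point K {i n})\<bar> < e)" for n
    using CK_finite_dependence[OF f point_in_cube e, of "{i n}"] by metis
  then obtain G where G: "\<And>n. finite (G n)" "\<And>n. G n \<subseteq> K"
    "\<And>n y. y \<in> topspace (cantor_cube K) \<Longrightarrow> (\<And>\<kappa>. \<kappa> \<in> G n \<Longrightarrow> y \<kappa> = point K {i n} \<kappa>) \<Longrightarrow> \<bar>f y - f (point K {i n})\<bar> < e"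
    by metis
  \<comment> \<open>Outside F the points with support \<open>i n\<close> all look like the zero
    point, which handles those n together through two errors of \<open>e/2\<close>. Only finitely
    many n have \<open>i n\<close> in F, and each brings its own finite set
    \<open>G n\<close>.\<close>
  let ?H = "F \<union> (\<Union>n\<in>i -` F. G n)"
  have "\<bar>jump n L f\<bar> < e" if L: "j L \<notin> ?H" for n L
  proof (cases "i n \<in> F")
    case True
    have "point K {i n, j L} \<kappa> = point K {i n} \<kappa>" if "\<kappa> \<in> G n" for \<kappa>
    proof -
      have "\<kappa> \<in> K" "\<kappa> \<noteq> j L" using that L True G(2)[of n] by auto
      then show ?thesis by simp
    qed
    then show ?thesis unfolding jump_def by (intro G(3)) auto
  next
    case False
    have 1: "\<bar>f (point K {i n, j L}) - f (point K {})\<bar> < e/2"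
      by (rule F(2)) (use L False FK in auto)
    have 2: "\<bar>f (point K {i n}) - f (point K {})\<bar> < e/2"
      by (rule F(2)) (use False FK in auto)
    show ?thesis using 1 2 unfolding jump_def by linarith
  qed
  then have "{L. \<exists>n. e \<le> \<bar>jump n L f\<bar>} \<subseteq> j -` ?H" by (force simp: not_le[symmetric])
  moreover have "finite (j -` ?H)"
    using F(1) G(1) inj_i inj_j by (intro finite_vimageI finite_UnI finite_UN_I) auto
  ultimately show ?thesis by (rule finite_subset)
qed

text \<open>The index of the first true coordinate among the \<open>i m\<close> is n; being first is
  what makes these sets disjoint.\<close>

definition cyl :: "nat \<Rightarrow> ('k \<Rightarrow> bool) \<Rightarrow> bool" where
  "cyl n x \<longleftrightarrow> x (i n) \<and> (\<forall>m<n. \<not> x (i m))"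

lemma cyl_disjoint: "cyl n x \<Longrightarrow> cyl m x \<Longrightarrow> n = m"
  unfolding cyl_def by (metis linorder_neqE_nat)

text \<open>The unit ball of C(\<open>cyl n\<close>), extended by 0: one pointwise inequality bounds
  the norm and confines the support.\<close>

definition cyl_ball :: "nat \<Rightarrow> (('k \<Rightarrow> bool) \<Rightarrow> real) set" where
  "cyl_ball n = {f \<in> CK_set K. \<forall>x. \<bar>f x\<bar> \<le> of_bool (cyl n x)}"

text \<open>L codes, through the pairing function, a sequence of subsets of nat.\<close>
definition decode :: "nat set \<Rightarrow> nat \<Rightarrow> nat set" where
  "decode L n = {k. prod_encode (n, k) \<in> L}"

text \<open>When no such n exists the value is arbitrary and \<open>ads L\<close> is finite; the
  family stays almost disjoint in any case. For the L that codes a section, such an n is found in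
  the proof of \<open>nontrivial\<close>.\<close>

definition level :: "nat set \<Rightarrow> nat" where
  "level L = (SOME n. infinite (branch L - decode L n))"

definition ads :: "nat set \<Rightarrow> nat set" where
  "ads L = branch L - decode L (level L)"

sublocale null_functionals "CK_set K" "CK_norm K" "\<lambda>L. jump (level L) L" 2 ads
proof
  show "banach_on (CK_set K) (CK_norm K)" by (rule banach_on_CK)
  fix f L assume f: "f \<in> CK_set K"
  show "\<bar>jump (level L) L f\<bar> \<le> 2 * CK_norm K f"
    using abs_le_sup_norm[of f "topspace (cantor_cube K)" "point K {i (level L), j L}"]
      abs_le_sup_norm[of f "topspace (cantor_cube K)" "point K {i (level L)}"] f CK_set_subset[of K]
    by (force simp: jump_def CK_norm_eq)
  \<comment> \<open>Here n varies with L through \<open>level\<close>, so finiteness is taken from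
    \<open>jump_null\<close>, which is uniform in n.\<close>
  show "finite {L. e \<le> \<bar>jump (level L) L f\<bar>}" if "e > 0" for e
    by (rule finite_subset[OF _ jump_null[OF f that]]) blast
next
  fix L L' :: "nat set" assume "L \<noteq> L'"
  then show "finite (ads L \<inter> ads L')"
    by (intro finite_subset[OF _ branch_almost_disjoint]) (auto simp: ads_def)
qed (auto simp: jump_def scaleR_fun_def right_diff_distrib)

lemma cyl_indicator:
  obtains f where "f \<in> cyl_ball n" "jump n L f = 1"
proof -
  let ?T = "topspace (cantor_cube K)"
  define f :: "('k \<Rightarrow> bool) \<Rightarrow> real" where
    "f x = (if x \<in> ?T \<and> cyl n x \<and> x (j L) then 1 else 0)" for x
  \<comment> \<open>On the cube g is the same indicator, written as a polynomial in finitely many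
    coordinates and so visibly continuous; f adds the value 0 off the cube.\<close>
  define g :: "('k \<Rightarrow> bool) \<Rightarrow> real" where
    "g x = of_bool (x (i n)) * of_bool (x (j L)) * (\<Prod>m<n. 1 - of_bool (x (i m)))" for x
  have "continuous_map (cantor_cube K) euclideanreal g"
    unfolding g_def by (intro continuous_intros continuous_map_coordinate i_in j_in) auto
  moreover have "g x = f x" if "x \<in> ?T" for x
    using that by (auto simp: f_def g_def cyl_def)
  ultimately have "f \<in> CK_set K"
    by (auto simp: CK_set_def f_def[of x for x] intro: continuous_map_eq)
  then have "f \<in> cyl_ball n" by (auto simp: cyl_ball_def f_def)
  moreover have "jump n L f = 1"
    using i_neq_j i_neq_j[symmetric] inj_i i_in j_in by (auto simp: jump_def f_def cyl_def inj_eq)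
  ultimately show thesis by (rule that)
qed

text \<open>The supports are disjoint, so a sum of N such functions with the right signs has norm at most
  1 but functional value at least N/2.\<close>
lemma large_cyl_balls_bounded:
  fixes h :: "(('k \<Rightarrow> bool) \<Rightarrow> real) \<Rightarrow> real"
  assumes add: "\<And>f g. f \<in> CK_set K \<Longrightarrow> g \<in> CK_set K \<Longrightarrow> h (f + g) = h f + h g"
    and scale: "\<And>f a. f \<in> CK_set K \<Longrightarrow> h (a *\<^sub>R f) = a * h f"
    and bounded: "\<And>f. f \<in> CK_set K \<Longrightarrow> \<bar>h f\<bar> \<le> C * CK_norm K f"
    and C: "C \<ge> 0" "2 * C < real N"
  shows "\<exists>n<N. \<forall>f\<in>cyl_ball n. \<bar>h f\<bar> < 1/2"
proof (rule ccontr)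
  assume "\<not> ?thesis"
  then have "\<exists>f\<in>cyl_ball n. 1/2 \<le> \<bar>h f\<bar>" if "n < N" for n
    using that by (meson not_le)
  moreover have "\<exists>f\<in>cyl_ball n. 1/2 \<le> h f" if "f \<in> cyl_ball n" "1/2 \<le> \<bar>h f\<bar>" for f n
  proof (cases "h f \<ge> 0")
    case False
    have "(-1) *\<^sub>R f \<in> cyl_ball n" using that(1) closed(4)[of f "-1"]
      by (simp add: cyl_ball_def)
    then show ?thesis using False that scale[of f "-1"]
      by (intro bexI[of _ "(-1) *\<^sub>R f"]) (auto simp: cyl_ball_def)
  qed (use that in auto)
  ultimately have "\<forall>n\<in>{..<N}. \<exists>f. f \<in> cyl_ball n \<and> 1/2 \<le> h f" by blast
  then obtain f where f: "\<And>n. n < N \<Longrightarrow> f n \<in> cyl_ball n" "\<And>n. n < N \<Longrightarrow> 1/2 \<le> h (f n)"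
    by (metis lessThan_iff)
  have sum: "sum f {..<M} \<in> CK_set K \<and> h (sum f {..<M}) \<ge> real M / 2" if "M \<le> N" for M
    using that
  proof (induction M)
    case 0
    have "h 0 = 0" using scale[of 0 0] closed(1) by simp
    then show ?case by (simp only: lessThan_0 sum.empty closed(1) of_nat_0 div_0 order_refl simp_thms)
  next
    case (Suc M)
    then have "f M \<in> CK_set K" "h (f M) \<ge> 1/2" using f[of M] by (auto simp: cyl_ball_def)
    moreover have "sum f {..<Suc M} = sum f {..<M} + f M" by (simp only: sum.lessThan_Suc)
    ultimately have "sum f {..<Suc M} \<in> CK_set K" "h (sum f {..<Suc M}) = h (sum f {..<M}) + h (f M)"
      using Suc closed(2) add by (simp_all only: Suc_leD)
    then show ?case using Suc \<open>h (f M) \<ge> 1/2\<close> by (simp only: of_nat_Suc) auto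
  qed
  have "\<bar>sum f {..<N} x\<bar> \<le> 1" for x
  proof -
    have 0: "f n x = 0" if "n < N" "\<not> cyl n x" for n
    proof -
      have "\<bar>f n x\<bar> \<le> of_bool (cyl n x)" using f(1)[OF that(1)] unfolding cyl_ball_def by blast
      then show ?thesis using that(2) by simp
    qed
    have eq: "sum f {..<N} x = (\<Sum>n<N. f n x)" by (induction N) auto
    show ?thesis
    proof (cases "\<exists>m<N. cyl m x")
      case True
      then obtain m where m: "m < N" "cyl m x" by blast
      have "(\<Sum>n<N. f n x) = (\<Sum>n<N. if n = m then f m x else 0)"
        using 0 cyl_disjoint m by (intro sum.cong) auto
      moreover have "\<bar>f m x\<bar> \<le> of_bool (cyl m x)" using f(1)[OF m(1)] unfolding cyl_ball_def by blast
      ultimately show ?thesis using eq m by simp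
    next
      case False
      then show ?thesis using eq 0 by simp
    qed
  qed
  then have "CK_norm K (sum f {..<N}) \<le> 1"
    unfolding CK_norm_eq by (intro sup_norm_le) (use point_in_cube in blast, simp)
  then have "\<bar>h (sum f {..<N})\<bar> \<le> C"
    using bounded[of "sum f {..<N}"] sum[of N] C(1) by (meson mult_left_le order_refl order_trans)
  then show False using sum[of N] C(2) by simp
qed

text \<open>A diagonal argument: a section determines a sequence of sets, coded by some L, and
  \<open>ads L\<close> was built in advance to avoid the set at \<open>level L\<close> of that very
  sequence.\<close>

lemma nontrivial: "\<not> trivial_twisted_sum c0_set (ad_twist ads (\<lambda>L. jump (level L) L) (CK_set K))
    (twist_norm (CK_norm K)) (\<lambda>s. (s, 0))"
proof
  assume "trivial_twisted_sum c0_set (ad_twist ads (\<lambda>L. jump (level L) L) (CK_set K))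
    (twist_norm (CK_norm K)) (\<lambda>s. (s, 0))"
  note triv = this
  obtain C S where C: "C \<ge> 0"
    and S: "\<forall>f\<in>CK_set K. S f \<in> ad_twist ads (\<lambda>L. jump (level L) L) (CK_set K) \<and> snd (S f) = f \<and>
      twist_norm (CK_norm K) (S f) \<le> C * CK_norm K f"
    and add: "\<forall>f\<in>CK_set K. \<forall>g\<in>CK_set K. S (f + g) = S f + S g"
    and scale: "\<forall>f\<in>CK_set K. \<forall>a. S (a *\<^sub>R f) = a *\<^sub>R S f"
    by (rule trivial_twisted_sum_section[OF twisted_sum_ad_twist triv])
  define h where "h k f = fst (S f) k" for k f
  have mem: "(\<lambda>k. h k f, f) \<in> ad_twist ads (\<lambda>L. jump (level L) L) (CK_set K)" if "f \<in> CK_set K" for f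
  proof -
    have "(\<lambda>k. h k f, f) = S f" using S that by (simp add: h_def prod_eq_iff)
    then show ?thesis using S that by simp
  qed
  have hC: "\<bar>h k f\<bar> \<le> C * CK_norm K f" if "f \<in> CK_set K" for k f
    using abs_le_sup_norm[OF ad_twistD(1)[OF mem[OF that]], of k] bspec[OF S that]
    by (simp add: twist_norm_def h_def)
  \<comment> \<open>The code of the section: \<open>decode L n\<close> consists of those k whose
    coordinate functional reaches 1/2 on \<open>cyl_ball n\<close>.\<close>
  define L where "L = {prod_encode (n, k) | n k. \<exists>f\<in>cyl_ball n. 1/2 \<le> \<bar>h k f\<bar>}"
  have dec: "decode L n = {k. \<exists>f\<in>cyl_ball n. 1/2 \<le> \<bar>h k f\<bar>}" for n
    by (auto simp: decode_def L_def)
  obtain N where N: "2 * C < real N" using reals_Archimedean2 by blast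
  have "\<exists>n<N. k \<notin> decode L n" for k
  proof -
    have "\<exists>n<N. \<forall>f\<in>cyl_ball n. \<bar>h k f\<bar> < 1/2"
      by (rule large_cyl_balls_bounded[OF _ _ hC C N], simp_all add: h_def add scale, simp add: scaleR_fun_def)
    then show ?thesis by (force simp: dec)
  qed
  \<comment> \<open>Every k is missed by one of the first N sets, so finitely many differences cover
    the infinite branch and one of them must be infinite.\<close>
  then have "branch L \<subseteq> (\<Union>n<N. branch L - decode L n)" by blast
  then have "infinite (\<Union>n<N. branch L - decode L n)"
    using infinite_branch infinite_super by blast
  then have "\<exists>n. infinite (branch L - decode L n)" by blast
  then have inf: "infinite (ads L)" unfolding ads_def level_def by (rule someI_ex)
  \<comment> \<open>Its jump is 1, so the lifted sequence is within 1/2 of 1 far out along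
    \<open>ads L\<close>, hence above 1/2 there. But \<open>ads L\<close> avoids
    \<open>decode L (level L)\<close>, which forces values below 1/2.\<close>
  obtain f where f: "f \<in> cyl_ball (level L)" "jump (level L) L f = 1" by (rule cyl_indicator)
  then have "f \<in> CK_set K" by (simp add: cyl_ball_def)
  from ad_twistD(3)[OF mem[OF this], of "1/2" L] f(2)
  obtain M where M: "\<And>k. k \<ge> M \<Longrightarrow> k \<in> ads L \<Longrightarrow> \<bar>h k f - 1\<bar> < 1/2"
    by (auto simp: eventually_sequentially)
  obtain k where k: "k \<in> ads L" "k \<ge> M"
    using inf by (meson infinite_nat_iff_unbounded_le)
  then have "k \<notin> decode L (level L)" by (simp add: ads_def)
  then have "\<bar>h k f\<bar> < 1/2" using f(1) by (auto simp: dec not_le)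
  with M[OF k(2,1)] show False by linarith
qed

end

theorem theorem3p5:
  fixes K :: "'k set"
  assumes card_ge_continuum: "\<exists>f :: real \<Rightarrow> 'k. inj f \<and> range f \<subseteq> K"
  shows "\<exists>(Z :: ((nat \<Rightarrow> real) \<times> (('k \<Rightarrow> bool) \<Rightarrow> real)) set) nZ i q.
           twisted_sum c0_set c0_norm Z nZ (CK_set K) (CK_norm K) i q \<and>
           \<not> trivial_twisted_sum c0_set Z nZ i"
proof -
  obtain i :: "nat \<Rightarrow> 'k" and j :: "nat set \<Rightarrow> 'k"
    where "inj i" "inj j" "range i \<subseteq> K" "range j \<subseteq> K" "\<And>n L. i n \<noteq> j L"
    using continuum_coordinates[OF card_ge_continuum] by metis
  then interpret cube_coordinates K i j by unfold_locales auto
  show ?thesis using twisted_sum_ad_twist nontrivial by blast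
qed

end
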